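(* Let $n\geq 2$, let $M,E\in\mathcal{K}^n$ with $\dim(E)=n$, and let $K=M+E$ (Minkowski sum). Then $$\mathrm{vol}(K)\geq \frac{\mathrm{S}(K;E)}{n-1}-\frac{\mathrm{vol}(E)}{n-1}.$$ Equality holds if and only if $\dim(M)\leq 1$.
   Context: $\mathcal{K}^n$ denotes the set of all convex bodies in $\mathbb{R}^n$, i.e., all non-empty compact convex subsets of $\mathbb{R}^n$. The dimension $\dim(\cdot)$ of a convex body is the dimension of its affine hull. For $K,E\in\mathcal{K}^n$, the relative quermassintegrals $\mathrm{W}_i(K;E)$, $0\leq i\leq n$, are the coefficients defined by the relative Steiner formula $\mathrm{vol}(K+\lambda E)=\sum_{i=0}^n\binom{n}{i}\mathrm{W}_i(K;E)\lambda^i$ for all $\lambda\geq 0$, where $\mathrm{vol}$ is Lebesgue measure and $+$ is Minkowski addition; that is, $\mathrm{W}_i(K;E)$ is the mixed volume with $K$ appearing $n-i$ times and $E$ appearing $i$ times. The relative Minkowski content of $K$ is $\mathrm{S}(K;E)=n\,\mathrm{W}_1(K;E)$. *)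

theory Defs
  imports "HOL-Analysis.Analysis" "HOL-Library.Set_Algebras"
begin

definition convex_body :: "(real ^ 'n) set \<Rightarrow> bool" where
  "convex_body K \<longleftrightarrow> K \<noteq> {} \<and> compact K \<and> convex K"

abbreviation vol :: "(real ^ 'n) set \<Rightarrow> real" where
  "vol K \<equiv> measure lebesgue K"

text \<open>Sums of sets are Minkowski sums. The Steiner formula determines \<open>w i\<close> only for
  \<open>i \<le> CARD('n)\<close>; the second conjunct makes the whole sequence \<open>w\<close> unique.\<close>

definition steiner_coeffs ::
    "(real ^ 'n) set \<Rightarrow> (real ^ 'n) set \<Rightarrow> (nat \<Rightarrow> real) \<Rightarrow> bool" where
  "steiner_coeffs K E w \<longleftrightarrow>
     (\<forall>t\<ge>0. vol (K + (*\<^sub>R) t ` E) =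
        (\<Sum>i=0..CARD('n). real (CARD('n) choose i) * w i * t ^ i)) \<and>
     (\<forall>i>CARD('n). w i = 0)"

definition quermassintegral ::
    "nat \<Rightarrow> (real ^ 'n) set \<Rightarrow> (real ^ 'n) set \<Rightarrow> real" where
  "quermassintegral i K E = (THE w. steiner_coeffs K E w) i"

definition minkowski_content :: "(real ^ 'n) set \<Rightarrow> (real ^ 'n) set \<Rightarrow> real" where
  "minkowski_content K E = real CARD('n) * quermassintegral 1 K E"

lemma steiner_coeffs_unique:
  fixes K E :: "(real ^ 'n) set"
  assumes "steiner_coeffs K E v" "steiner_coeffs K E w"
  shows "v = w"
proof
  fix i
  let ?n = "CARD('n)"
  let ?c = "\<lambda>i. real (?n choose i) * (v i - w i)"
  have z: "(\<Sum>i\<le>?n. ?c i * x ^ i) = 0" if "x \<ge> 0" for x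
  proof -
    have "(\<Sum>i=0..?n. real (?n choose i) * v i * x ^ i) =
          (\<Sum>i=0..?n. real (?n choose i) * w i * x ^ i)"
      using assms[unfolded steiner_coeffs_def, THEN conjunct1, rule_format, OF that]
      by (rule subst)
    then show ?thesis
      by (simp add: left_diff_distrib right_diff_distrib sum_subtractf atLeast0AtMost)
  qed
  have "{0..} \<subseteq> {x. (\<Sum>i\<le>?n. ?c i * x ^ i) = 0}"
    using z by auto
  then have inf: "infinite {x. (\<Sum>i\<le>?n. ?c i * x ^ i) = 0}"
    by (rule infinite_super) (rule infinite_Ici)
  show "v i = w i"
  proof (cases "i \<le> ?n")
    case True
    have "?c i = 0"
    proof (rule ccontr)
      assume "?c i \<noteq> 0"
      with True have "\<exists>j\<le>?n. ?c j \<noteq> 0"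
        by (intro exI[of _ i] conjI)
      then have "finite {x. (\<Sum>i\<le>?n. ?c i * x ^ i) = 0}"
        by (rule polyfun_finite_roots[of ?c ?n, THEN iffD2])
      with inf show False
        by (rule notE)
    qed
    with True show ?thesis
      by simp
  next
    case False
    with assms[unfolded steiner_coeffs_def, THEN conjunct2, rule_format, of i]
    show ?thesis
      by simp
  qed
qed

lemma quermassintegral_eq:
  "steiner_coeffs K E w \<Longrightarrow> quermassintegral i K E = w i"
  unfolding quermassintegral_def
  by (subst the_equality[of "steiner_coeffs K E" w]) (auto intro: steiner_coeffs_unique)

end

theory Submission
  imports Defs
begin

text \<open>
  Write \<open>vol (M + t E) = (\<Sum>i\<le>n. a i * t ^ i)\<close>. Since \<open>K + t E = M + (1 + t) E\<close>, one gets
  \<open>vol K = (\<Sum>i\<le>n. a i)\<close>, \<open>S(K;E) = (\<Sum>i\<le>n. i * a i)\<close> and \<open>vol E = a n\<close>, hence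
  \<open>(n - 1) vol K - S(K;E) + vol E = (\<Sum>i\<le>n - 2. (n - 1 - i) * a i)\<close>. So everything
  follows from \<open>a i \<ge> 0\<close>, together with the fact that \<open>a i = 0\<close> for all \<open>i \<le> n - 2\<close>
  precisely when \<open>M\<close> is at most one-dimensional.

  For polytopes \<open>M = conv V\<close>, \<open>E = conv W\<close> the sum \<open>s M + t E\<close> is the slice at \<open>(s, t)\<close> of the
  cone generated by \<open>(v, 1, 0)\<close> and \<open>(w, 0, 1)\<close> (the Cayley trick). Generic heights on
  the generators induce a regular triangulation of this cone into simplicial cones, whose slices are
  sums of two simplices, with volume a nonnegative constant times \<open>s ^ (n - i) * t ^ i\<close>. The general
  case follows by approximation from outside, since nonnegativity keeps the coefficients bounded.
  The vanishing of the low coefficients is read off the growth of \<open>vol (s M + E)\<close>, which is at most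
  linear in \<open>s\<close> if \<open>M\<close> is a segment and at least quadratic if \<open>M\<close> contains a triangle.
\<close>

section \<open>Linear images of convex bodies\<close>

lemma measure_scale:
  fixes S :: "(real ^ 'n) set"
  assumes "0 \<le> r"
  shows "vol ((*\<^sub>R) r ` S) = r ^ CARD('n) * vol S"
  using measure_lebesgue_affine[of r 0 S] assms by simp

lemma emeasure_open_Un_negligible:
  fixes U :: "'a::euclidean_space set"
  assumes "open U" "negligible N"
  shows "emeasure lebesgue (U \<union> N) = emeasure lebesgue U"
  using assms by (intro emeasure_Un_null_set) (auto simp: negligible_iff_null_sets)

text \<open>The library's transformation formula for linear maps needs a well-ordered index type.
  Here any index type is allowed: up to null sets an open set is a disjoint union of balls (Vitali),
  and all balls are scaled translates of each other.\<close>

lemma emeasure_linear_image_open: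
  fixes f :: "'a::euclidean_space \<Rightarrow> 'a"
  assumes f: "linear f"
  obtains c :: real where "0 \<le> c"
    "\<And>S. open S \<Longrightarrow> emeasure lebesgue (f ` S) = ennreal c * emeasure lebesgue S"
proof (cases "inj f")
  \<comment> \<open>A singular map sends everything into a proper subspace, so the factor is
    0.\<close>
  case False
  have "emeasure lebesgue (f ` S) = 0" for S
    using negligible_linear_singular_image[OF f False, of S]
    by (simp add: negligible_iff_null_sets null_sets_def)
  then show thesis by (intro that[of 0]) auto
next
  case True
  have surj: "surj f" using True f by (simp add: linear_injective_imp_surjective)
  have open_image: "open (f ` S)" if "open S" for S
    using that f surj by (simp add: open_surjective_linear_image)
  let ?B = "ball 0 1 :: 'a set"
  \<comment> \<open>Balls are all similar, so the image of the unit ball fixes the only possible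
    factor.\<close>
  define c where "c = measure lebesgue (f ` ?B) / measure lebesgue ?B"
  have "bounded (f ` ?B)" using f by (simp add: bounded_linear_image linear_conv_bounded_linear)
  then have fin: "f ` ?B \<in> lmeasurable" "?B \<in> lmeasurable"
    using open_image[of ?B] by (auto intro: lmeasurable_open)
  have pos: "0 < measure lebesgue ?B" by simp
  have "0 \<le> c" unfolding c_def by simp
  have unit: "emeasure lebesgue (f ` ?B) = ennreal c * emeasure lebesgue ?B"
    using fin pos \<open>0 \<le> c\<close>
    by (simp add: emeasure_eq_measure2 c_def ennreal_mult[symmetric])
  have ball: "emeasure lebesgue (f ` ball a r) = ennreal c * emeasure lebesgue (ball a r)"
    if "0 < r" for a r
  proof -
    have B: "ball a r = (\<lambda>x. r *\<^sub>R x + a) ` ?B"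
    proof (intro set_eqI iffI)
      fix y assume "y \<in> ball a r"
      moreover have "norm ((y - a) /\<^sub>R r) = norm (y - a) / r" using that by (simp add: divide_inverse)
      ultimately have "(y - a) /\<^sub>R r \<in> ?B"
        using that unfolding mem_ball_0 by (simp add: dist_norm norm_minus_commute)
      moreover have "y = r *\<^sub>R ((y - a) /\<^sub>R r) + a" using that by simp
      ultimately show "y \<in> (\<lambda>x. r *\<^sub>R x + a) ` ?B" by blast
    qed (use that in \<open>auto simp: dist_norm\<close>)
    have "f ` ball a r = (\<lambda>x. r *\<^sub>R x + f a) ` f ` ?B"
      unfolding B image_image using f by (simp add: linear_add linear_scale)
    then show ?thesis
      unfolding B using unit by (simp add: emeasure_lebesgue_affine mult_ac)
  qed
  have "emeasure lebesgue (f ` S) = ennreal c * emeasure lebesgue S" if S: "open S" for S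
  proof -
    \<comment> \<open>Arbitrarily small balls inside \<open>S\<close> around each of its points: the
      fine cover to which Vitali's theorem applies.\<close>
    define K where "K = {(a, r). 0 < r \<and> ball a r \<subseteq> S}"
    have cover: "\<exists>i. i \<in> K \<and> x \<in> ball (fst i) (snd i) \<and> snd i < d" if x: "x \<in> S" "0 < d" for x d
    proof -
      obtain e where e: "0 < e" "ball x e \<subseteq> S" using S x(1) by (meson open_contains_ball)
      then have "(x, min e (d/2)) \<in> K"
        using x(2) e subset_ball[of "min e (d/2)" e x] by (simp add: K_def)
      then show ?thesis using e x by (intro exI[of _ "(x, min e (d/2))"]) auto
    qed
    obtain C where C: "countable C" "C \<subseteq> K"
      "pairwise (\<lambda>i j. disjnt (ball (fst i) (snd i)) (ball (fst j) (snd j))) C"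
      "negligible (S - (\<Union>i\<in>C. ball (fst i) (snd i)))"
      by (rule Vitali_covering_theorem_balls[OF cover])
    define b where "b = (\<lambda>i::'a\<times>real. ball (fst i) (snd i))"
    have "b i \<subseteq> S" if "i \<in> K" for i using that by (cases i) (simp add: K_def b_def)
    then have sub: "(\<Union>i\<in>C. b i) \<subseteq> S" using C(2) by blast
    have disj: "disjoint_family_on b C"
      using C(3) by (auto simp: disjoint_family_on_def pairwise_def disjnt_def b_def)
    have disj': "disjoint_family_on (\<lambda>i. f ` b i) C"
      using disj True unfolding disjoint_family_on_def by (metis image_Int image_empty)
    have opens: "open (b i)" for i by (simp add: b_def)
    have "emeasure lebesgue S = emeasure lebesgue (\<Union>i\<in>C. b i)"
    proof -
      have "S = (\<Union>i\<in>C. b i) \<union> (S - (\<Union>i\<in>C. b i))" using sub by blast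
      moreover have "open (\<Union>i\<in>C. b i)" using opens by blast
      ultimately show ?thesis
        using C(4) emeasure_open_Un_negligible unfolding b_def by metis
    qed
    also have "\<dots> = (\<integral>\<^sup>+i. emeasure lebesgue (b i) \<partial>count_space C)"
      using C(1) disj opens by (intro emeasure_UN_countable) auto
    finally have 1: "emeasure lebesgue S = (\<integral>\<^sup>+i. emeasure lebesgue (b i) \<partial>count_space C)" .
    \<comment> \<open>Linear maps are differentiable and hence send null sets to null sets, so the
      part missed by the balls stays null.\<close>
    have "negligible (f ` (S - (\<Union>i\<in>C. b i)))"
      using C(4) f unfolding b_def
      by (intro negligible_differentiable_image_negligible[OF order_refl])
        (auto simp: linear_imp_differentiable_on)
    moreover have "f ` S = (\<Union>i\<in>C. f ` b i) \<union> f ` (S - (\<Union>i\<in>C. b i))" using sub by blast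
    moreover have "open (\<Union>i\<in>C. f ` b i)" using open_image opens by blast
    ultimately have "emeasure lebesgue (f ` S) = emeasure lebesgue (\<Union>i\<in>C. f ` b i)"
      using emeasure_open_Un_negligible by metis
    also have "\<dots> = (\<integral>\<^sup>+i. emeasure lebesgue (f ` b i) \<partial>count_space C)"
      using C(1) disj' opens open_image by (intro emeasure_UN_countable) auto
    also have "\<dots> = (\<integral>\<^sup>+i. ennreal c * emeasure lebesgue (b i) \<partial>count_space C)"
      by (rule nn_integral_cong) (use C(2) ball in \<open>auto simp: K_def b_def\<close>)
    also have "\<dots> = ennreal c * emeasure lebesgue S"
      unfolding 1 by (rule nn_integral_cmult) simp
    finally show ?thesis .
  qed
  with \<open>0 \<le> c\<close> that show thesis by blast
qed

text \<open>The frontier of a convex set is negligible, and so is its linear image. Both measures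
  are therefore carried by the interior, where the open case applies.\<close>

lemma measure_linear_image_convex:
  fixes f :: "'a::euclidean_space \<Rightarrow> 'a"
  assumes f: "linear f"
  obtains c :: real where
    "\<And>S. convex S \<Longrightarrow> compact S \<Longrightarrow> measure lebesgue (f ` S) = c * measure lebesgue S"
proof -
  obtain c where c: "0 \<le> c"
    "\<And>S. open S \<Longrightarrow> emeasure lebesgue (f ` S) = ennreal c * emeasure lebesgue S"
    using emeasure_linear_image_open[OF f] by blast
  have "measure lebesgue (f ` S) = c * measure lebesgue S" if S: "convex S" "compact S" for S
  proof -
    have fr: "negligible (S - interior S)"
      using negligible_convex_frontier[OF S(1)] S(2)
      by (simp add: frontier_def compact_imp_closed)
    have "negligible (f ` (S - interior S))"
      using fr f by (intro negligible_differentiable_image_negligible[OF order_refl])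
        (auto simp: linear_imp_differentiable_on)
    then have fr': "negligible (f ` S - f ` interior S)"
      by (rule negligible_subset) auto
    have comp: "compact (f ` S)"
      using S f by (intro compact_continuous_image linear_continuous_on)
        (simp_all add: linear_conv_bounded_linear)
    have "measure lebesgue S = measure lebesgue (interior S)"
    proof (rule measure_negligible_symdiff)
      show "interior S \<in> lmeasurable"
        using S by (intro lmeasurable_interior) (simp add: compact_imp_bounded)
      show "negligible (interior S - S \<union> (S - interior S))"
        using fr interior_subset[of S] by (simp add: Diff_eq_empty_iff[THEN iffD2])
    qed
    moreover have "measure lebesgue (f ` interior S) = measure lebesgue (f ` S)"
    proof (rule measure_negligible_symdiff)
      show "f ` S \<in> lmeasurable" using comp by (rule lmeasurable_compact)
      have "f ` interior S - f ` S = {}" using interior_subset[of S] by blast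
      then show "negligible (f ` S - f ` interior S \<union> (f ` interior S - f ` S))"
        using fr' by simp
    qed
    moreover have "measure lebesgue (f ` interior S) = c * measure lebesgue (interior S)"
      unfolding measure_def using c by (simp add: enn2real_mult)
    ultimately show ?thesis by simp
  qed
  then show thesis using that by blast
qed

section \<open>Regular triangulations of finitely generated cones\<close>

text \<open>Indexing the weights by \<open>X\<close> instead of its image avoids merging weights
  when \<open>f\<close> is not injective. It serves for the lifts \<open>z\<close> to
  \<open>(z, c z)\<close> and for the two halves of \<open>cayley\<close>.\<close>

lemma convex_cone_hull_finite_image:
  fixes f :: "'b \<Rightarrow> 'a::real_vector"
  assumes "finite X"
  shows "convex_cone hull (f ` X) = {p. \<exists>l. (\<forall>z\<in>X. 0 \<le> l z) \<and> p = (\<Sum>z\<in>X. l z *\<^sub>R f z)}"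
    (is "_ = ?C")
proof (rule hull_unique)
  show "f ` X \<subseteq> ?C"
  proof clarify
    fix z assume "z \<in> X"
    with assms have "f z = (\<Sum>x\<in>X. (if x = z then 1 else 0) *\<^sub>R f x)"
      by (simp add: if_distrib[of "\<lambda>a. a *\<^sub>R _"] cong: if_cong)
    then show "\<exists>l. (\<forall>z\<in>X. 0 \<le> l z) \<and> f z = (\<Sum>z\<in>X. l z *\<^sub>R f z)"
      by (intro exI[of _ "\<lambda>x. if x = z then 1 else 0"]) auto
  qed
  show "convex_cone ?C"
    unfolding convex_cone_iff
  proof safe
    show "\<exists>l. (\<forall>z\<in>X. 0 \<le> l z) \<and> 0 = (\<Sum>z\<in>X. l z *\<^sub>R f z)"
      by (rule exI[of _ "\<lambda>_. 0"]) simp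
  next
    fix k l :: "'b \<Rightarrow> real" assume "\<forall>z\<in>X. 0 \<le> k z" "\<forall>z\<in>X. 0 \<le> l z"
    then show "\<exists>j. (\<forall>z\<in>X. 0 \<le> j z) \<and>
        (\<Sum>z\<in>X. k z *\<^sub>R f z) + (\<Sum>z\<in>X. l z *\<^sub>R f z) = (\<Sum>z\<in>X. j z *\<^sub>R f z)"
      by (intro exI[of _ "\<lambda>z. k z + l z"]) (simp add: scaleR_left_distrib sum.distrib)
  next
    fix l :: "'b \<Rightarrow> real" and r :: real assume "\<forall>z\<in>X. 0 \<le> l z" "0 \<le> r"
    then show "\<exists>j. (\<forall>z\<in>X. 0 \<le> j z) \<and> r *\<^sub>R (\<Sum>z\<in>X. l z *\<^sub>R f z) = (\<Sum>z\<in>X. j z *\<^sub>R f z)"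
      by (intro exI[of _ "\<lambda>z. r * l z"]) (simp add: scaleR_sum_right)
  qed
next
  fix T assume T: "f ` X \<subseteq> T" "convex_cone T"
  have "(\<Sum>z\<in>Y. l z *\<^sub>R f z) \<in> T" if "\<forall>z\<in>X. 0 \<le> l z" "finite Y" "Y \<subseteq> X" for l Y
    using that(2,3)
  proof (induction Y rule: finite_induct)
    case empty
    show ?case using T(2) by (simp add: convex_cone_iff)
  next
    case (insert y Y)
    then show ?case using T that(1) by (auto simp: convex_cone_iff)
  qed
  then show "?C \<subseteq> T" using assms by blast
qed

lemma convex_cone_hull_finite:
  fixes X :: "'a::real_vector set"
  assumes "finite X"
  shows "convex_cone hull X = {p. \<exists>l. (\<forall>z\<in>X. 0 \<le> l z) \<and> p = (\<Sum>z\<in>X. l z *\<^sub>R z)}"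
  using convex_cone_hull_finite_image[OF assms, of "\<lambda>x. x"] by simp

lemma convex_cone_hull_subset_span: "convex_cone hull X \<subseteq> span X"
  by (simp add: convex_cone_span hull_minimal span_superset)

text \<open>When the heights are chosen one by one, each must avoid the finitely many values forced by
  linear dependence on points already treated.\<close>

lemma generic_heights:
  fixes X :: "'a::real_inner set"
  assumes "finite X"
  shows "\<exists>c::'a \<Rightarrow> real. (\<forall>z. 0 < c z) \<and> (\<forall>u. independent {z\<in>X. u \<bullet> z = c z})"
  using assms
proof (induction X rule: finite_induct)
  case empty
  show ?case by (rule exI[of _ "\<lambda>_. 1"]) (simp add: independent_empty)
next
  case (insert z X)
  then obtain c where c: "\<And>z. 0 < c z" "\<And>u. independent {z\<in>X. u \<bullet> z = c z}" by blast
  \<comment> \<open>If \<open>u\<close> attains the heights on an independent \<open>T\<close> whose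
    span contains \<open>z\<close>, then \<open>u \<bullet> z\<close> is the value listed for
    \<open>T\<close>. For other subsets \<open>representation\<close> is 0 by default, which merely
    adds the value 0.\<close>
  define bad where "bad = (\<lambda>T. \<Sum>b\<in>T. representation T z b * c b) ` Pow X"
  have "finite bad" unfolding bad_def using insert by simp
  then have "\<not> {0<..} \<subseteq> bad" using infinite_super[OF _ infinite_Ioi] by blast
  then obtain y where y: "0 < y" "y \<notin> bad" by auto
  have "independent {x\<in>insert z X. u \<bullet> x = (c(z:=y)) x}" for u
  proof -
    define T where "T = {x\<in>X. u \<bullet> x = c x}"
    have T: "independent T" "T \<subseteq> X" "finite T" "\<And>x. x \<in> T \<Longrightarrow> u \<bullet> x = c x"
      using c insert unfolding T_def by auto
    show ?thesis
    proof (cases "u \<bullet> z = y")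
      case False
      then have "{x\<in>insert z X. u \<bullet> x = (c(z:=y)) x} = T" using insert T_def by auto
      with T show ?thesis by simp
    next
      case True
      have eq: "{x\<in>insert z X. u \<bullet> x = (c(z:=y)) x} = insert z T"
        using True insert T_def by auto
      have "z \<notin> span T"
      proof
        assume z: "z \<in> span T"
        have "u \<bullet> z = u \<bullet> (\<Sum>b\<in>T. representation T z b *\<^sub>R b)"
          using sum_representation_eq[OF T(1) z T(3) order_refl] by simp
        also have "\<dots> = (\<Sum>b\<in>T. representation T z b * c b)"
          by (simp add: inner_sum_right T(4))
        finally have "y \<in> bad" using T(2) True unfolding bad_def by auto
        with y show False by simp
      qed
      then show ?thesis unfolding eq using T by (simp add: independent_insertI)
    qed
  qed
  moreover have "\<forall>x. 0 < (c(z:=y)) x" using c y by simp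
  ultimately show ?case by blast
qed

text \<open>Linear programming duality. Lift each generator \<open>z\<close> to
  \<open>(z, c z)\<close>; over \<open>p\<close> the lifted cone has a lowest point, since it is
  closed and the heights are nonnegative. A hyperplane supporting the lifted cone at that point is
  the graph of the wanted \<open>u\<close>, and \<open>generic\<close> excludes a vertical
  one.\<close>

lemma lower_facet_exists:
  fixes X :: "'a::euclidean_space set" and c :: "'a \<Rightarrow> real"
  assumes X: "finite X" and c: "\<And>z. z \<in> X \<Longrightarrow> 0 \<le> c z"
    and p: "p \<in> convex_cone hull X"
    and generic: "\<And>Y. Y \<subseteq> X \<Longrightarrow> span Y \<noteq> UNIV \<Longrightarrow> p \<notin> span Y"
  obtains u where "\<forall>z\<in>X. u \<bullet> z \<le> c z" "p \<in> convex_cone hull {z\<in>X. u \<bullet> z = c z}"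
proof -
  define L where "L = convex_cone hull ((\<lambda>z. (z, c z)) ` X)"
  have L_iff: "q \<in> L \<longleftrightarrow> (\<exists>l. (\<forall>z\<in>X. 0 \<le> l z) \<and>
      q = ((\<Sum>z\<in>X. l z *\<^sub>R z), (\<Sum>z\<in>X. l z * c z)))" for q
    unfolding L_def convex_cone_hull_finite_image[OF X] by (simp add: sum_prod)
  have cone: "convex_cone L" unfolding L_def by (rule convex_cone_convex_cone_hull)
  have "closed L" unfolding L_def using X by (simp add: closed_convex_cone_hull)
  then have closed: "closed {y. (p, y) \<in> L}"
    using continuous_closed_vimage[of L "\<lambda>y. (p, y)"] by (simp add: vimage_def)
  have bdd: "bdd_below {y. (p, y) \<in> L}"
    by (rule bdd_belowI[of _ 0]) (auto simp: L_iff c intro!: sum_nonneg)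
  have "{y. (p, y) \<in> L} \<noteq> {}"
    using p unfolding convex_cone_hull_finite[OF X] by (auto simp: L_iff)
  then have min: "(p, m) \<in> L" "\<And>y. (p, y) \<in> L \<Longrightarrow> m \<le> y" if "m = Inf {y. (p, y) \<in> L}" for m
    using closed_contains_Inf[OF _ bdd closed] cInf_lower[OF _ bdd] that by auto
  define m where "m = Inf {y. (p, y) \<in> L}"
  note min = min[OF m_def]
  \<comment> \<open>The open ray below the lowest point \<open>(p, m)\<close> is separated from the
    set of points on or above the lifted cone.\<close>
  define R A where "R = {p} \<times> {..<m}" and "A = {(q, y). \<exists>y'\<le>y. (q, y') \<in> L}"
  have "convex R" unfolding R_def by (intro convex_Times) auto
  have A: "convex_cone A"
    unfolding convex_cone_iff
  proof safe
    show "0 \<in> A" using cone by (auto simp: A_def convex_cone_iff zero_prod_def)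
  next
    fix q y q' y' assume "(q, y) \<in> A" "(q', y') \<in> A"
    then obtain z z' where "z \<le> y" "(q, z) \<in> L" "z' \<le> y'" "(q', z') \<in> L" by (auto simp: A_def)
    moreover have "(q, z) + (q', z') \<in> L" using calculation cone convex_cone_add by blast
    ultimately show "(q, y) + (q', y') \<in> A"
      unfolding A_def by (auto intro!: exI[of _ "z + z'"])
  next
    fix q y and r :: real assume "(q, y) \<in> A" "0 \<le> r"
    then obtain z where z: "z \<le> y" "(q, z) \<in> L" by (auto simp: A_def)
    have "r *\<^sub>R (q, z) \<in> L" using z \<open>0 \<le> r\<close> cone convex_cone_scaleR by blast
    with z \<open>0 \<le> r\<close> show "r *\<^sub>R (q, y) \<in> A"
      unfolding A_def by (auto intro!: exI[of _ "r * z"] mult_left_mono)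
  qed
  have "R \<noteq> {}" "A \<noteq> {}" using min(1) by (auto simp: R_def A_def intro: lt_ex)
  moreover have "R \<inter> A = {}" using min(2) unfolding R_def A_def by fastforce
  moreover have "convex A" using A by (simp add: convex_cone_def)
  ultimately obtain a b where ab: "a \<noteq> 0" "\<forall>x\<in>R. a \<bullet> x \<le> b" "\<forall>x\<in>A. a \<bullet> x \<ge> b"
    using separating_hyperplane_sets[of R A] \<open>convex R\<close> by blast
  obtain v \<beta> where a: "a = (v, \<beta>)" by (cases a)
  have b: "b \<le> 0" using ab(3) A by (auto simp: convex_cone_iff)
  \<comment> \<open>A functional bounded below on a cone is nonnegative there: otherwise some
    multiple of \<open>x\<close> takes the value \<open>b - 1\<close>.\<close>
  have nonneg: "0 \<le> a \<bullet> x" if "x \<in> A" for x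
  proof (rule ccontr)
    assume neg: "\<not> 0 \<le> a \<bullet> x"
    define r where "r = (b - 1) / (a \<bullet> x)"
    have "0 \<le> r" using neg b unfolding r_def by (simp add: divide_nonpos_neg)
    then have "r *\<^sub>R x \<in> A" using A that convex_cone_scaleR by blast
    then have "b \<le> a \<bullet> (r *\<^sub>R x)" using ab(3) by blast
    also have "\<dots> = b - 1" using neg unfolding r_def by simp
    finally show False by simp
  qed
  have zA: "(z, c z) \<in> A" if "z \<in> X" for z
    unfolding A_def L_def using that by (auto intro!: exI[of _ "c z"] hull_inc)
  have pA: "(p, m + r) \<in> A" if "0 \<le> r" for r
    unfolding A_def using min(1) that by (auto intro!: exI[of _ m])
  have le: "v \<bullet> p + \<beta> * y \<le> b" if "y < m" for y
    using ab(2) that by (auto simp: R_def a)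
  have \<beta>: "0 \<le> \<beta>"
  proof (rule ccontr)
    assume "\<not> 0 \<le> \<beta>"
    moreover have "v \<bullet> p + \<beta> * (m - 1) \<le> 0" using le[of "m - 1"] b by simp
    moreover have "0 \<le> v \<bullet> p + \<beta> * m" using nonneg[OF pA[of 0]] by (simp add: a)
    ultimately show False by (simp add: algebra_simps)
  qed
  have "v \<bullet> p + \<beta> * m \<le> 0"
  proof (rule field_le_epsilon)
    fix e :: real assume "0 < e"
    define d where "d = e / (\<beta> + 1)"
    have d: "0 < d" "\<beta> * d \<le> e" using \<open>0 < e\<close> \<beta> unfolding d_def
      by (auto simp: field_simps)
    have "v \<bullet> p + \<beta> * (m - d) \<le> 0" using le[of "m - d"] d b by simp
    then show "v \<bullet> p + \<beta> * m \<le> 0 + e" using d by (simp add: algebra_simps)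
  qed
  moreover have "0 \<le> v \<bullet> p + \<beta> * m" using nonneg[OF pA[of 0]] by (simp add: a)
  ultimately have m: "v \<bullet> p + \<beta> * m = 0" by simp
  obtain l where l: "\<forall>z\<in>X. 0 \<le> l z" "p = (\<Sum>z\<in>X. l z *\<^sub>R z)" "m = (\<Sum>z\<in>X. l z * c z)"
    using min(1) by (auto simp: L_iff)
  have z: "0 \<le> v \<bullet> z + \<beta> * c z" if "z \<in> X" for z
    using nonneg[OF zA[OF that]] by (simp add: a)
  have "(\<Sum>z\<in>X. l z * (v \<bullet> z + \<beta> * c z)) = 0"
    using m unfolding l(2,3)
    by (simp add: inner_sum_right sum_distrib_left sum.distrib algebra_simps)
  \<comment> \<open>A vanishing sum of nonnegative terms: an optimal representation of
    \<open>p\<close> puts weight only on generators in the supporting hyperplane.\<close>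
  then have tight: "l z = 0 \<or> v \<bullet> z + \<beta> * c z = 0" if "z \<in> X" for z
    using that l(1) z X by (subst (asm) sum_nonneg_eq_0_iff) auto
  define Y where "Y = {z\<in>X. v \<bullet> z + \<beta> * c z = 0}"
  have "p = (\<Sum>z\<in>Y. l z *\<^sub>R z)"
    unfolding l(2) by (rule sum.mono_neutral_right) (use X tight in \<open>auto simp: Y_def\<close>)
  moreover have "finite Y" "\<forall>z\<in>Y. 0 \<le> l z" using X l(1) by (auto simp: Y_def)
  ultimately have pY: "p \<in> convex_cone hull Y" by (auto simp: convex_cone_hull_finite)
  \<comment> \<open>A vertical hyperplane would contain all of \<open>Y\<close> in the kernel of
    \<open>v\<close>. But \<open>p\<close> lies in the span of \<open>Y\<close>, so by genericity
    \<open>Y\<close> spans the whole space.\<close>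
  have "\<beta> \<noteq> 0"
  proof
    assume "\<beta> = 0"
    then have "Y \<subseteq> {z. v \<bullet> z = 0}" by (auto simp: Y_def)
    then have "span Y \<subseteq> {z. v \<bullet> z = 0}" by (simp add: span_minimal subspace_hyperplane)
    moreover have "span Y = UNIV"
      using generic[of Y] pY convex_cone_hull_subset_span[of Y] by (auto simp: Y_def)
    ultimately have "v \<bullet> v = 0" by blast
    then show False using ab(1) a \<open>\<beta> = 0\<close> by (simp add: zero_prod_def)
  qed
  with \<beta> have "0 < \<beta>" by simp
  \<comment> \<open>Solving \<open>v \<bullet> z + \<beta> * y = 0\<close> for \<open>y\<close>
    gives the supporting hyperplane as a graph.\<close>
  define u where "u = - (v /\<^sub>R \<beta>)"
  have u: "u \<bullet> z = - (v \<bullet> z) / \<beta>" for z unfolding u_def by (simp add: divide_inverse)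
  have "u \<bullet> z \<le> c z" if "z \<in> X" for z
    using z[OF that] \<open>0 < \<beta>\<close> unfolding u by (simp add: field_simps)
  moreover have "{z\<in>X. u \<bullet> z = c z} = Y"
    using \<open>0 < \<beta>\<close> unfolding u Y_def by (auto simp: field_simps)
  ultimately show thesis using that pY by blast
qed

text \<open>Complementary slackness: a representation of \<open>p\<close> by generators tight for \<open>u\<close> is tight for \<open>v\<close> as well.\<close>

lemma lower_facets_overlap:
  fixes X :: "'a::real_inner set" and c :: "'a \<Rightarrow> real"
  assumes X: "finite X"
    and u: "\<forall>z\<in>X. u \<bullet> z \<le> c z" and v: "\<forall>z\<in>X. v \<bullet> z \<le> c z"
    and pu: "p \<in> convex_cone hull {z\<in>X. u \<bullet> z = c z}"
    and pv: "p \<in> convex_cone hull {z\<in>X. v \<bullet> z = c z}"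
  shows "p \<in> span ({z\<in>X. u \<bullet> z = c z} \<inter> {z\<in>X. v \<bullet> z = c z})"
proof -
  define B C where "B = {z\<in>X. u \<bullet> z = c z}" and "C = {z\<in>X. v \<bullet> z = c z}"
  have fin: "finite B" "finite C" using X by (auto simp: B_def C_def)
  obtain k where k: "\<forall>z\<in>B. 0 \<le> k z" "p = (\<Sum>z\<in>B. k z *\<^sub>R z)"
    using pu fin unfolding B_def by (auto simp: convex_cone_hull_finite)
  obtain l where l: "\<forall>z\<in>C. 0 \<le> l z" "p = (\<Sum>z\<in>C. l z *\<^sub>R z)"
    using pv fin unfolding C_def by (auto simp: convex_cone_hull_finite)
  have "u \<bullet> p \<le> v \<bullet> p"
  proof -
    have "u \<bullet> p = (\<Sum>z\<in>C. l z * (u \<bullet> z))" unfolding l(2) by (simp add: inner_sum_right)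
    also have "\<dots> \<le> (\<Sum>z\<in>C. l z * (v \<bullet> z))"
      by (rule sum_mono) (use l u in \<open>auto simp: C_def intro!: mult_left_mono\<close>)
    also have "\<dots> = v \<bullet> p" unfolding l(2) by (simp add: inner_sum_right)
    finally show ?thesis .
  qed
  moreover have slack: "(\<Sum>z\<in>B. k z * (c z - v \<bullet> z)) = u \<bullet> p - v \<bullet> p"
    unfolding k(2) inner_sum_right sum_subtractf[symmetric]
    by (rule sum.cong) (auto simp: B_def algebra_simps)
  moreover have nn: "0 \<le> k z * (c z - v \<bullet> z)" if "z \<in> B" for z
    using that k v by (auto simp: B_def)
  ultimately have "(\<Sum>z\<in>B. k z * (c z - v \<bullet> z)) = 0"
    by (metis (no_types, lifting) antisym diff_le_0_iff_le sum_nonneg)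
  then have "\<forall>z\<in>B. k z = 0 \<or> z \<in> C"
    using nn fin by (subst (asm) sum_nonneg_eq_0_iff) (auto simp: B_def C_def)
  then have p: "p = (\<Sum>z\<in>B \<inter> C. k z *\<^sub>R z)"
    unfolding k(2) by (intro sum.mono_neutral_right) (use fin in auto)
  then show ?thesis
    unfolding B_def[symmetric] C_def[symmetric]
    by (subst p) (intro span_sum span_scale span_base)
qed

section \<open>Sums of simplices\<close>

lemma compact_set_plus:
  fixes A B :: "'a::real_normed_vector set"
  assumes "compact A" "compact B"
  shows "compact (A + B)"
  unfolding set_plus_image using assms
  by (intro compact_continuous_image compact_Times) (auto simp: split_def intro!: continuous_intros)

lemma scaled_convex_hull_finite:
  fixes V :: "'a::real_vector set"
  assumes "finite V" "0 < s"
  shows "x \<in> (*\<^sub>R) s ` (convex hull V) \<longleftrightarrow>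
    (\<exists>l. (\<forall>v\<in>V. 0 \<le> l v) \<and> sum l V = s \<and> x = (\<Sum>v\<in>V. l v *\<^sub>R v))"
proof
  assume "x \<in> (*\<^sub>R) s ` (convex hull V)"
  then obtain k where k: "\<forall>v\<in>V. 0 \<le> k v" "sum k V = 1" "x = s *\<^sub>R (\<Sum>v\<in>V. k v *\<^sub>R v)"
    using assms by (auto simp: convex_hull_finite)
  then show "\<exists>l. (\<forall>v\<in>V. 0 \<le> l v) \<and> sum l V = s \<and> x = (\<Sum>v\<in>V. l v *\<^sub>R v)"
    using assms by (intro exI[of _ "\<lambda>v. s * k v"])
      (simp add: scaleR_sum_right sum_distrib_left[symmetric])
next
  assume "\<exists>l. (\<forall>v\<in>V. 0 \<le> l v) \<and> sum l V = s \<and> x = (\<Sum>v\<in>V. l v *\<^sub>R v)"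
  then obtain l where l: "\<forall>v\<in>V. 0 \<le> l v" "sum l V = s" "x = (\<Sum>v\<in>V. l v *\<^sub>R v)" by blast
  have "(\<Sum>v\<in>V. (l v / s) *\<^sub>R v) \<in> convex hull V"
    using l assms
    by (auto simp: convex_hull_finite sum_divide_distrib[symmetric] intro!: exI[of _ "\<lambda>v. l v / s"])
  moreover have "x = s *\<^sub>R (\<Sum>v\<in>V. (l v / s) *\<^sub>R v)"
    using assms l(3) by (simp add: scaleR_sum_right)
  ultimately show "x \<in> (*\<^sub>R) s ` (convex hull V)" by blast
qed

text \<open>Eliminating the weight of the vertex \<open>v0\<close> turns the constraint on the total
  weight into an inequality. The remaining weights are the coordinates used to parametrise a
  simplex.\<close>

lemma scaled_convex_hull_insert_finite:
  fixes V :: "'a::real_vector set"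
  assumes "finite V" "v0 \<notin> V" "0 < s"
  shows "x \<in> (*\<^sub>R) s ` (convex hull (insert v0 V)) \<longleftrightarrow>
    (\<exists>l. (\<forall>v\<in>V. 0 \<le> l v) \<and> sum l V \<le> s \<and> x = s *\<^sub>R v0 + (\<Sum>v\<in>V. l v *\<^sub>R (v - v0)))"
    (is "?L \<longleftrightarrow> ?R")
proof -
  have eq: "(\<Sum>v\<in>V. l v *\<^sub>R (v - v0)) = (\<Sum>v\<in>V. l v *\<^sub>R v) - sum l V *\<^sub>R v0" for l
    by (simp add: scaleR_right_diff_distrib sum_subtractf scaleR_left.sum)
  have fin: "finite (insert v0 V)" using assms by simp
  show ?thesis
  proof
    assume ?L
    then obtain l where l: "\<forall>v\<in>insert v0 V. 0 \<le> l v" "sum l (insert v0 V) = s"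
      "x = (\<Sum>v\<in>insert v0 V. l v *\<^sub>R v)"
      using scaled_convex_hull_finite[OF fin \<open>0 < s\<close>] by blast
    have "l v0 = s - sum l V" using l(2) assms by simp
    then show ?R using l assms
      by (intro exI[of _ l]) (auto simp: eq scaleR_left_diff_distrib)
  next
    assume ?R
    then obtain l where l: "\<forall>v\<in>V. 0 \<le> l v" "sum l V \<le> s"
      "x = s *\<^sub>R v0 + (\<Sum>v\<in>V. l v *\<^sub>R (v - v0))" by blast
    define k where "k = l(v0 := s - sum l V)"
    have k: "k v = l v" if "v \<in> V" for v using that assms by (auto simp: k_def)
    have "sum k (insert v0 V) = s" "\<forall>v\<in>insert v0 V. 0 \<le> k v"
      using assms l k by (auto simp: k_def cong: sum.cong)
    moreover have "x = (\<Sum>v\<in>insert v0 V. k v *\<^sub>R v)"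
      using assms k unfolding l(3) eq
      by (simp add: scaleR_left_diff_distrib k cong: sum.cong) (simp add: k_def algebra_simps)
    ultimately show ?L using scaled_convex_hull_finite[OF fin \<open>0 < s\<close>] by blast
  qed
qed

text \<open>With one vertex of each simplex as origin, the sum is the translate of a linear image of
  a product of two corner simplices in \<open>card S - 1\<close> and \<open>card T - 1\<close>
  coordinates. Dilating by \<open>s\<close> and \<open>t\<close> stretches the two blocks of
  coordinates, while the linear map and its volume factor stay the same.\<close>

lemma volume_simplex_sum:
  fixes S T :: "(real ^ 'n) set"
  assumes fin: "finite S" "finite T" and ne: "S \<noteq> {}" "T \<noteq> {}"
    and card: "card S + card T = CARD('n) + 2"
    and st: "0 < s" "0 < t"
  shows "vol ((*\<^sub>R) s ` (convex hull S) + (*\<^sub>R) t ` (convex hull T)) =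
    s ^ (card S - 1) * t ^ (card T - 1) * vol (convex hull S + convex hull T)"
proof -
  obtain v0 w0 where "v0 \<in> S" "w0 \<in> T" using ne by blast
  define S' T' where "S' = S - {v0}" and "T' = T - {w0}"
  have S': "finite S'" "v0 \<notin> S'" "S = insert v0 S'" "card S' = card S - 1"
    using fin \<open>v0 \<in> S\<close> by (auto simp: S'_def)
  have T': "finite T'" "w0 \<notin> T'" "T = insert w0 T'" "card T' = card T - 1"
    using fin \<open>w0 \<in> T\<close> by (auto simp: T'_def)
  have "card S > 0" "card T > 0" using fin ne by (auto simp: card_gt_0_iff)
  then have "card (S' <+> T') = CARD('n)" using S'(1,4) T'(1,4) card by (simp add: card_Plus)
  \<comment> \<open>The coordinates of the space are labelled by the vertices other than
    \<open>v0\<close> and \<open>w0\<close>, whose number is exactly n by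
    \<open>card\<close>.\<close>
  then obtain h where h: "bij_betw h (S' <+> T') (UNIV :: 'n set)"
    using finite_same_card_bij[of "S' <+> T'" "UNIV::'n set"] S'(1) T'(1) by auto
  define f where "f = the_inv_into (S' <+> T') h"
  have fh: "f (h d) = d" if "d \<in> S' <+> T'" for d
    using h that unfolding f_def bij_betw_def by (simp add: the_inv_into_f_f)
  have f_Inl: "f (h (Inl v)) = Inl v" if "v \<in> S'" for v using that by (intro fh) (rule InlI)
  have f_Inr: "f (h (Inr v)) = Inr v" if "v \<in> T'" for v using that by (intro fh) (rule InrI)
  have k_cases: "\<exists>d\<in>S' <+> T'. k = h d" for k
    using h unfolding bij_betw_def by blast
  \<comment> \<open>The product of the two corner simplices, of sizes \<open>s\<close> and
    \<open>t\<close>; \<open>L\<close> maps it onto the sum up to translation.\<close>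
  define Q where "Q = (\<lambda>s t. {y::real^'n. (\<forall>k. 0 \<le> y$k) \<and>
    (\<Sum>v\<in>S'. y$(h (Inl v))) \<le> s \<and> (\<Sum>w\<in>T'. y$(h (Inr w))) \<le> t})"
  define L where "L = (\<lambda>y::real^'n. (\<Sum>v\<in>S'. y$(h (Inl v)) *\<^sub>R (v - v0)) +
    (\<Sum>w\<in>T'. y$(h (Inr w)) *\<^sub>R (w - w0)))"
  have "linear L"
    unfolding L_def
    by (intro linearI)
      (simp_all add: scaleR_left_distrib sum.distrib scaleR_sum_right scaleR_right_distrib)
  \<comment> \<open>The stretching factor of coordinate \<open>k\<close>: \<open>s\<close> in the
    block of \<open>S'\<close> and \<open>t\<close> in the block of \<open>T'\<close>.\<close>
  define m where "m = (\<lambda>s t k. case f k of Inl _ \<Rightarrow> s | Inr _ \<Rightarrow> (t::real))"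
  have mS: "m s t (h (Inl v)) = s" if "v \<in> S'" for v s t
    using that by (auto simp: m_def f_Inl f_Inr)
  have mT: "m s t (h (Inr v)) = t" if "v \<in> T'" for v s t
    using that by (auto simp: m_def f_Inl f_Inr)
  have image: "(*\<^sub>R) s ` (convex hull S) + (*\<^sub>R) t ` (convex hull T) =
      (\<lambda>x. (s *\<^sub>R v0 + t *\<^sub>R w0) + x) ` L ` Q s t" if "0 < s" "0 < t" for s t
  proof (intro set_eqI iffI)
    fix x assume "x \<in> (*\<^sub>R) s ` (convex hull S) + (*\<^sub>R) t ` (convex hull T)"
    then obtain a b where ab: "a \<in> (*\<^sub>R) s ` (convex hull S)" "b \<in> (*\<^sub>R) t ` (convex hull T)"
      "x = a + b" by (rule set_plus_elim)
    obtain l where l: "\<forall>v\<in>S'. 0 \<le> l v" "sum l S' \<le> s"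
      "a = s *\<^sub>R v0 + (\<Sum>v\<in>S'. l v *\<^sub>R (v - v0))"
      using ab(1) S'(1-3) \<open>0 < s\<close> scaled_convex_hull_insert_finite[of S' v0 s a] by blast
    obtain k where k: "\<forall>v\<in>T'. 0 \<le> k v" "sum k T' \<le> t"
      "b = t *\<^sub>R w0 + (\<Sum>v\<in>T'. k v *\<^sub>R (v - w0))"
      using ab(2) T'(1-3) \<open>0 < t\<close> scaled_convex_hull_insert_finite[of T' w0 t b] by blast
    define y where "y = (\<chi> i::'n. case f i of Inl v \<Rightarrow> l v | Inr w \<Rightarrow> k w)"
    have y: "y $ h (Inl v) = l v" if "v \<in> S'" for v using that by (auto simp: y_def f_Inl f_Inr)
    have y': "y $ h (Inr v) = k v" if "v \<in> T'" for v using that by (auto simp: y_def f_Inl f_Inr)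
    have "0 \<le> y $ i" for i using k_cases[of i] y y' l(1) k(1) by auto
    then have "y \<in> Q s t" using l k by (simp add: Q_def y y' cong: sum.cong)
    moreover have "x = (s *\<^sub>R v0 + t *\<^sub>R w0) + L y"
      unfolding ab(3) l(3) k(3) L_def by (simp add: y y' cong: sum.cong)
    ultimately show "x \<in> (\<lambda>x. (s *\<^sub>R v0 + t *\<^sub>R w0) + x) ` L ` Q s t" by blast
  next
    fix x assume "x \<in> (\<lambda>x. (s *\<^sub>R v0 + t *\<^sub>R w0) + x) ` L ` Q s t"
    then obtain y where y: "y \<in> Q s t" "x = (s *\<^sub>R v0 + t *\<^sub>R w0) + L y" by blast
    have "s *\<^sub>R v0 + (\<Sum>v\<in>S'. y$(h (Inl v)) *\<^sub>R (v - v0)) \<in> (*\<^sub>R) s ` (convex hull S)"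
      unfolding S'(3) scaled_convex_hull_insert_finite[OF S'(1,2) \<open>0 < s\<close>]
      by (rule exI[of _ "\<lambda>v. y$(h (Inl v))"]) (use y(1) in \<open>simp add: Q_def\<close>)
    moreover have "t *\<^sub>R w0 + (\<Sum>v\<in>T'. y$(h (Inr v)) *\<^sub>R (v - w0)) \<in> (*\<^sub>R) t ` (convex hull T)"
      unfolding T'(3) scaled_convex_hull_insert_finite[OF T'(1,2) \<open>0 < t\<close>]
      by (rule exI[of _ "\<lambda>v. y$(h (Inr v))"]) (use y(1) in \<open>simp add: Q_def\<close>)
    moreover have "x = (s *\<^sub>R v0 + (\<Sum>v\<in>S'. y$(h (Inl v)) *\<^sub>R (v - v0))) +
        (t *\<^sub>R w0 + (\<Sum>v\<in>T'. y$(h (Inr v)) *\<^sub>R (v - w0)))"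
      unfolding y(2) L_def by simp
    ultimately show "x \<in> (*\<^sub>R) s ` (convex hull S) + (*\<^sub>R) t ` (convex hull T)"
      by (simp only: set_plus_intro)
  qed
  have stretch: "Q s t = (\<lambda>y. \<chi> k. m s t k * y$k) ` Q 1 1"
  proof (intro set_eqI iffI)
    have mpos: "0 < m s t k" for k using st by (auto simp: m_def split: sum.split)
    fix y assume y: "y \<in> Q s t"
    define z where "z = (\<chi> k. y$k / m s t k)"
    have "z \<in> Q 1 1"
      using y st mpos unfolding Q_def z_def
      by (auto simp: mS mT sum_divide_distrib[symmetric] less_imp_le cong: sum.cong)
    moreover have "y = (\<chi> k. m s t k * z$k)"
      using mpos by (simp add: z_def vec_eq_iff less_imp_neq[symmetric])
    ultimately show "y \<in> (\<lambda>y. \<chi> k. m s t k * y$k) ` Q 1 1" by blast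
  next
    have mpos: "0 < m s t k" for k using st by (auto simp: m_def split: sum.split)
    fix y assume "y \<in> (\<lambda>y. \<chi> k. m s t k * y$k) ` Q 1 1"
    then show "y \<in> Q s t"
      using st mpos unfolding Q_def
      by (auto simp: mS mT sum_distrib_left[symmetric] less_imp_le cong: sum.cong)
  qed
  have compact: "compact (Q a b)" for a b
  proof -
    have "closed (Q a b)"
      unfolding Q_def
      by (intro closed_Collect_conj closed_Collect_all closed_Collect_le continuous_intros)
    moreover have "Q a b \<subseteq> cbox 0 (\<chi> k. max a b)"
    proof
      fix y assume y: "y \<in> Q a b"
      have "y $ h (Inl v) \<le> max a b" if "v \<in> S'" for v
        using member_le_sum[of v S' "\<lambda>v. y $ h (Inl v)"] that S'(1) y unfolding Q_def by auto
      moreover have "y $ h (Inr v) \<le> max a b" if "v \<in> T'" for v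
        using member_le_sum[of v T' "\<lambda>v. y $ h (Inr v)"] that T'(1) y unfolding Q_def by auto
      ultimately have "y $ k \<le> max a b" for k using k_cases[of k] by auto
      with y show "y \<in> cbox 0 (\<chi> k. max a b)" by (auto simp: mem_box_cart Q_def)
    qed
    ultimately show ?thesis
      using bounded_cbox bounded_subset compact_eq_bounded_closed by blast
  qed
  have convex: "convex (Q a b)" for a b
    unfolding convex_def Q_def
    by (auto simp: sum.distrib sum_distrib_left[symmetric] intro!: convex_bound_le)
  obtain c where c: "\<And>A. convex A \<Longrightarrow> compact A \<Longrightarrow> vol (L ` A) = c * vol A"
    using measure_linear_image_convex[OF \<open>linear L\<close>] by blast
  have vol: "vol ((*\<^sub>R) a ` (convex hull S) + (*\<^sub>R) b ` (convex hull T)) = c * vol (Q a b)"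
    if "0 < a" "0 < b" for a b
    unfolding image[OF that] by (simp only: measure_translation c[OF convex compact])
  have "vol (Q s t) = \<bar>\<Prod>k\<in>UNIV. m s t k\<bar> * vol (Q 1 1)"
    unfolding stretch by (rule measure_stretch[OF lmeasurable_compact[OF compact]])
  also have "(\<Prod>k\<in>UNIV. m s t k) = (\<Prod>d\<in>S' <+> T'. m s t (h d))"
    using prod.reindex_bij_betw[OF h] by metis
  also have "\<dots> = (\<Prod>v\<in>S'. m s t (h (Inl v))) * (\<Prod>v\<in>T'. m s t (h (Inr v)))"
    using S'(1) T'(1) by (simp add: prod.Plus comp_def)
  also have "\<dots> = s ^ (card S - 1) * t ^ (card T - 1)"
    using S'(4) T'(4) by (simp add: mS mT cong: prod.cong)
  finally have "vol (Q s t) = s ^ (card S - 1) * t ^ (card T - 1) * vol (Q 1 1)"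
    using st by (simp add: abs_mult)
  then show ?thesis
    using vol[OF st] vol[of 1 1] by simp
qed

section \<open>The Steiner formula for polytopes\<close>

definition cayley ::
    "(real ^ 'n) set \<Rightarrow> (real ^ 'n) set \<Rightarrow> ((real ^ 'n) \<times> real \<times> real) set" where
  "cayley V W = (\<lambda>v. (v, 1, 0)) ` V \<union> (\<lambda>w. (w, 0, 1)) ` W"

lemma mem_cayley [simp]:
  "(v, 1, 0) \<in> cayley V W \<longleftrightarrow> v \<in> V" "(w, 0, 1) \<in> cayley V W \<longleftrightarrow> w \<in> W"
  by (auto simp: cayley_def)

text \<open>The last two coordinates of a conic combination are the total weights on
  \<open>V\<close> and on \<open>W\<close>. Fixing them at \<open>s\<close> and \<open>t\<close>
  leaves a point of each dilated hull.\<close>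

lemma cayley_cone_slice:
  fixes V W :: "(real ^ 'n) set"
  assumes "finite V" "finite W" "0 < s" "0 < t"
  shows "(x, s, t) \<in> convex_cone hull (cayley V W) \<longleftrightarrow>
    x \<in> (*\<^sub>R) s ` (convex hull V) + (*\<^sub>R) t ` (convex hull W)"
proof -
  have "(x, s, t) \<in> convex_cone hull (cayley V W) \<longleftrightarrow>
      (\<exists>a\<in>convex_cone hull ((\<lambda>v. (v, 1, 0)) ` V). \<exists>b\<in>convex_cone hull ((\<lambda>w. (w, 0, 1)) ` W).
        (x, s, t) = a + b)"
    unfolding cayley_def convex_cone_hull_Un by blast
  also have "\<dots> \<longleftrightarrow> (\<exists>l k. (\<forall>v\<in>V. 0 \<le> l v) \<and> (\<forall>w\<in>W. 0 \<le> k w) \<and>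
      (x, s, t) = (\<Sum>v\<in>V. l v *\<^sub>R (v, 1, 0)) + (\<Sum>w\<in>W. k w *\<^sub>R (w, 0, 1)))"
    unfolding convex_cone_hull_finite_image[OF assms(1)] convex_cone_hull_finite_image[OF assms(2)]
    by blast
  also have "\<dots> \<longleftrightarrow> (\<exists>l k. (\<forall>v\<in>V. 0 \<le> l v) \<and> (\<forall>w\<in>W. 0 \<le> k w) \<and> sum l V = s \<and> sum k W = t \<and>
      x = (\<Sum>v\<in>V. l v *\<^sub>R v) + (\<Sum>w\<in>W. k w *\<^sub>R w))"
    by (intro ex_cong1) (auto simp: sum_prod)
  also have "\<dots> \<longleftrightarrow> (\<exists>a\<in>(*\<^sub>R) s ` (convex hull V). \<exists>b\<in>(*\<^sub>R) t ` (convex hull W). x = a + b)"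
    unfolding Bex_def scaled_convex_hull_finite[OF assms(1,3)] scaled_convex_hull_finite[OF assms(2,4)]
    by blast
  finally show ?thesis by (simp add: set_plus_def)
qed

text \<open>A proper span lies in a hyperplane with normal
  \<open>(\<alpha>, \<beta>, \<gamma>)\<close>. If \<open>\<alpha>\<close> is nonzero, the slice
  lies in a hyperplane too. Otherwise the slice is empty: nonzero \<open>s\<close> and
  \<open>t\<close> require generators of both kinds in \<open>Y\<close>, and these force
  \<open>\<beta>\<close> and \<open>\<gamma>\<close> to vanish.\<close>

lemma negligible_cayley_slice:
  fixes V W :: "(real ^ 'n) set"
  assumes Y: "Y \<subseteq> cayley V W" "span Y \<noteq> UNIV" and st: "s \<noteq> 0" "t \<noteq> 0"
  shows "negligible {x. (x, s, t) \<in> span Y}"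
proof -
  obtain \<alpha> \<beta> \<gamma> where ne: "(\<alpha>, \<beta>, \<gamma>) \<noteq> (0 :: (real^'n) \<times> real \<times> real)"
    and sub: "span Y \<subseteq> {z. (\<alpha>, \<beta>, \<gamma>) \<bullet> z = 0}"
    using span_not_univ_subset_hyperplane[OF Y(2)] by (metis prod.exhaust)
  show ?thesis
  proof (cases "\<alpha> = 0")
    case False
    have "{x. (x, s, t) \<in> span Y} \<subseteq> {x. \<alpha> \<bullet> x = - (\<beta> * s + \<gamma> * t)}"
      using sub by auto
    then show ?thesis using negligible_hyperplane[of \<alpha>] False negligible_subset by blast
  next
    case True
    have "(x, s, t) \<notin> span Y" for x
    proof
      assume x: "(x, s, t) \<in> span Y"
      have Y_hyper: "span Y \<subseteq> {z. e \<bullet> z = 0}" if "\<And>z. z \<in> Y \<Longrightarrow> e \<bullet> z = 0" for e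
        using that by (intro span_minimal subspace_hyperplane) auto
      have "\<exists>v. (v, 1, 0) \<in> Y"
      proof (rule ccontr)
        assume "\<not> ?thesis"
        then have "span Y \<subseteq> {z. (0, 1, 0) \<bullet> z = 0}"
          using Y(1) by (intro Y_hyper) (auto simp: cayley_def)
        then show False using x st by auto
      qed
      moreover have "\<exists>w. (w, 0, 1) \<in> Y"
      proof (rule ccontr)
        assume "\<not> ?thesis"
        then have "span Y \<subseteq> {z. (0, 0, 1) \<bullet> z = 0}"
          using Y(1) by (intro Y_hyper) (auto simp: cayley_def)
        then show False using x st by auto
      qed
      ultimately obtain v w where "(v, 1, 0) \<in> Y" "(w, 0, 1) \<in> Y" by blast
      then have "(v, 1, 0) \<in> span Y" "(w, 0, 1) \<in> span Y" by (simp_all add: span_base)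
      then have "\<beta> = 0" "\<gamma> = 0" using sub True by auto
      then show False using ne True by (simp add: zero_prod_def)
    qed
    then show ?thesis by simp
  qed
qed

text \<open>The slices of the simplicial cones cover the sum up to a null set by
  \<open>lower_facet_exists\<close>, overlap in null sets by \<open>lower_facets_overlap\<close>,
  and each contributes a single monomial by \<open>volume_simplex_sum\<close>. The cones are fixed
  before \<open>s\<close> and \<open>t\<close>, so the coefficients do not depend on them.\<close>

lemma polytope_steiner:
  fixes V W :: "(real ^ 'n) set"
  assumes fin: "finite V" "finite W"
  shows "\<exists>a. (\<forall>i. 0 \<le> a i) \<and> (\<forall>s>0. \<forall>t>0.
    vol ((*\<^sub>R) s ` (convex hull V) + (*\<^sub>R) t ` (convex hull W)) =
    (\<Sum>i\<le>CARD('n). a i * s ^ (CARD('n) - i) * t ^ i))"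
proof -
  define X where "X = cayley V W"
  have X: "finite X" using fin by (simp add: X_def cayley_def)
  obtain c where c: "\<And>z. 0 < c z" "\<And>u. independent {z\<in>X. u \<bullet> z = c z}"
    using generic_heights[OF X] by blast
  define tight where "tight u = {z\<in>X. u \<bullet> z = c z}" for u
  \<comment> \<open>The maximal cells of the regular triangulation; generic heights make each of
    them a basis.\<close>
  define F where "F = {tight u |u. (\<forall>z\<in>X. u \<bullet> z \<le> c z) \<and> span (tight u) = UNIV}"
  have F_sub: "B \<subseteq> X" if "B \<in> F" for B using that by (auto simp: F_def tight_def)
  have finF: "finite F" by (rule finite_subset[of _ "Pow X"]) (use F_sub X in auto)
  have F_indep: "independent B" "span B = UNIV" if "B \<in> F" for B
    using that c(2) by (auto simp: F_def tight_def)
  have basis_card: "card B = CARD('n) + 2"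
    if "independent B" "span B = UNIV" for B :: "((real^'n) \<times> real \<times> real) set"
    using dim_eq_card_independent[OF that(1)] dim_span[of B] that(2)
    by simp
  define VB WB where "VB B = {v. (v, 1, 0) \<in> B}" and "WB B = {w. (w, 0, 1) \<in> B}"
    for B :: "((real^'n) \<times> real \<times> real) set"
  have split: "B = cayley (VB B) (WB B)" if "B \<in> F" for B
  proof
    show "B \<subseteq> cayley (VB B) (WB B)"
    proof
      fix z assume z: "z \<in> B"
      then have "z \<in> X" using F_sub[OF that] by blast
      then show "z \<in> cayley (VB B) (WB B)"
        unfolding X_def cayley_def using z by (auto simp: VB_def WB_def)
    qed
  qed (auto simp: cayley_def VB_def WB_def)
  have VW: "finite (VB B)" "finite (WB B)" if "B \<in> F" for B
  proof -
    have B: "z \<in> cayley V W" if "z \<in> B" for z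
      using F_sub[OF \<open>B \<in> F\<close>] that unfolding X_def by blast
    have "VB B \<subseteq> V" "WB B \<subseteq> W"
      unfolding VB_def WB_def using mem_cayley B by blast+
    then show "finite (VB B)" "finite (WB B)" using fin finite_subset by blast+
  qed
  have card: "card (VB B) + card (WB B) = CARD('n) + 2" if "B \<in> F" for B
  proof -
    have "card B = card ((\<lambda>v. (v, 1::real, 0::real)) ` VB B) + card ((\<lambda>w. (w, 0::real, 1::real)) ` WB B)"
      by (subst split[OF that], unfold cayley_def, rule card_Un_disjoint) (use VW[OF that] in auto)
    also have "\<dots> = card (VB B) + card (WB B)"
      by (simp add: card_image inj_on_def)
    finally show ?thesis using basis_card F_indep[OF that] by simp
  qed
  \<comment> \<open>A spanning set cannot lie in the hyperplane where one of the last two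
    coordinates vanishes, so both kinds of generators occur.\<close>
  have ne: "VB B \<noteq> {}" "WB B \<noteq> {}" if "B \<in> F" for B
  proof -
    have hyper: "\<exists>z\<in>B. e \<bullet> z \<noteq> 0" if "e \<noteq> 0" for e
    proof (rule ccontr)
      assume "\<not> ?thesis"
      then have "span B \<subseteq> {z. e \<bullet> z = 0}" by (intro span_minimal subspace_hyperplane) auto
      then have "e \<bullet> e = 0" using F_indep(2)[OF \<open>B \<in> F\<close>] by blast
      with that show False by simp
    qed
    obtain z where z: "z \<in> B" "(0, 1, 0) \<bullet> z \<noteq> 0"
      using hyper[of "(0, 1, 0)"] by (auto simp: zero_prod_def)
    with F_sub[OF that] have "z \<in> cayley V W" unfolding X_def by blast
    with z show "VB B \<noteq> {}" by (auto simp: VB_def cayley_def)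
    obtain z where z: "z \<in> B" "(0, 0, 1) \<bullet> z \<noteq> 0"
      using hyper[of "(0, 0, 1)"] by (auto simp: zero_prod_def)
    with F_sub[OF that] have "z \<in> cayley V W" unfolding X_def by blast
    with z show "WB B \<noteq> {}" by (auto simp: WB_def cayley_def)
  qed
  define q where "q B = vol (convex hull (VB B) + convex hull (WB B))" for B
  \<comment> \<open>A cell contributes to the coefficient whose index is its exponent of
    \<open>t\<close>, the dimension of its simplex from \<open>W\<close>.\<close>
  define a where "a i = (\<Sum>B\<in>F. if card (WB B) - 1 = i then q B else 0)" for i
  have "0 \<le> a i" for i unfolding a_def q_def by (intro sum_nonneg) auto
  moreover have "vol ((*\<^sub>R) s ` (convex hull V) + (*\<^sub>R) t ` (convex hull W)) =
      (\<Sum>i\<le>CARD('n). a i * s ^ (CARD('n) - i) * t ^ i)" if st: "0 < s" "0 < t" for s t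
  proof -
    define P where "P = (*\<^sub>R) s ` (convex hull V) + (*\<^sub>R) t ` (convex hull W)"
    define slice where "slice B = {x. (x, s, t) \<in> convex_cone hull B}"
      for B :: "((real^'n) \<times> real \<times> real) set"
    \<comment> \<open>The finitely many degenerate slices: off this set every
      \<open>(x, s, t)\<close> is generic in the sense of \<open>lower_facet_exists\<close>.\<close>
    define N where "N = (\<Union>Y\<in>{Y \<in> Pow X. span Y \<noteq> UNIV}. {x. (x, s, t) \<in> span Y})"
    have P: "P = slice X"
      unfolding P_def slice_def X_def using cayley_cone_slice[OF fin st] by blast
    have slice: "slice B = (*\<^sub>R) s ` (convex hull (VB B)) + (*\<^sub>R) t ` (convex hull (WB B))"
      if "B \<in> F" for B
      using cayley_cone_slice[OF VW[OF that] st] split[OF that] unfolding slice_def by auto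
    have meas: "slice B \<in> lmeasurable" if "B \<in> F" for B
      unfolding slice[OF that] using VW[OF that]
      by (intro lmeasurable_compact compact_set_plus compact_scaling) (simp_all add: finite_imp_compact_convex_hull)
    have "negligible N"
      unfolding N_def using st X
      by (intro negligible_Union) (auto intro!: negligible_cayley_slice simp: X_def)
    have sub: "(\<Union>B\<in>F. slice B) \<subseteq> P"
      unfolding P slice_def using F_sub hull_mono by blast
    have cover: "P - (\<Union>B\<in>F. slice B) \<subseteq> N"
    proof
      fix x assume x: "x \<in> P - (\<Union>B\<in>F. slice B)"
      show "x \<in> N"
      proof (rule ccontr)
        assume "x \<notin> N"
        then have generic: "(x, s, t) \<notin> span Y" if "Y \<subseteq> X" "span Y \<noteq> UNIV" for Y
          using that unfolding N_def by blast
        have hx: "(x, s, t) \<in> convex_cone hull X" using x by (simp add: P slice_def)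
        obtain u where u: "\<forall>z\<in>X. u \<bullet> z \<le> c z" "(x, s, t) \<in> convex_cone hull (tight u)"
          unfolding tight_def
          by (rule lower_facet_exists[OF X less_imp_le[OF c(1)] hx generic])
        have "(x, s, t) \<in> span (tight u)" using u(2) convex_cone_hull_subset_span by blast
        then have "span (tight u) = UNIV" using generic[of "tight u"] by (auto simp: tight_def)
        then have "tight u \<in> F" using u(1) unfolding F_def by blast
        with u(2) x show False unfolding slice_def by blast
      qed
    qed
    have "vol P = vol (\<Union>B\<in>F. slice B)"
    proof (rule measure_negligible_symdiff)
      show "(\<Union>B\<in>F. slice B) \<in> lmeasurable" using finF meas by (intro fmeasurable.finite_UN) auto
      show "negligible ((\<Union>B\<in>F. slice B) - P \<union> (P - (\<Union>B\<in>F. slice B)))"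
        by (rule negligible_subset[OF \<open>negligible N\<close>]) (use sub cover in blast)
    qed
    also have "\<dots> = (\<Sum>B\<in>F. vol (slice B))"
    proof (rule measure_negligible_finite_Union_image[OF finF meas])
      show "pairwise (\<lambda>B C. negligible (slice B \<inter> slice C)) F"
      proof (rule pairwiseI)
        fix B C assume BC: "B \<in> F" "C \<in> F" "B \<noteq> C"
        \<comment> \<open>If the intersection spanned, it would be a basis of the same cardinality
          as \<open>B\<close> and \<open>C\<close>, making them equal.\<close>
        have "span (B \<inter> C) \<noteq> UNIV"
        proof
          assume full: "span (B \<inter> C) = UNIV"
          have "independent (B \<inter> C)"
            using F_indep(1)[OF BC(1)] independent_mono by blast
          then have "card (B \<inter> C) = CARD('n) + 2" using full by (rule basis_card)
          moreover have "card B = CARD('n) + 2" "card C = CARD('n) + 2"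
            using basis_card F_indep BC by blast+
          moreover have "finite B" "finite C" using BC F_sub X finite_subset by blast+
          ultimately have "B \<inter> C = B" "B \<inter> C = C"
            by (metis Int_lower1 Int_lower2 card_subset_eq)+
          with BC(3) show False by blast
        qed
        moreover have "B \<inter> C \<subseteq> X" using F_sub[OF BC(1)] by blast
        moreover have "slice B \<inter> slice C \<subseteq> {x. (x, s, t) \<in> span (B \<inter> C)}"
          using BC(1,2) lower_facets_overlap[OF X] unfolding F_def slice_def tight_def by blast
        ultimately have "slice B \<inter> slice C \<subseteq> N" unfolding N_def by blast
        then show "negligible (slice B \<inter> slice C)"
          using \<open>negligible N\<close> negligible_subset by blast
      qed
    qed
    also have "\<dots> = (\<Sum>B\<in>F. s ^ (card (VB B) - 1) * t ^ (card (WB B) - 1) * q B)"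
      unfolding q_def
    proof (rule sum.cong)
      fix B assume B: "B \<in> F"
      show "vol (slice B) = s ^ (card (VB B) - 1) * t ^ (card (WB B) - 1) *
          vol (convex hull (VB B) + convex hull (WB B))"
        unfolding slice[OF B] by (rule volume_simplex_sum[OF VW[OF B] ne[OF B] card[OF B] st])
    qed simp
    also have "\<dots> = (\<Sum>B\<in>F. \<Sum>i\<le>CARD('n).
        (if card (WB B) - 1 = i then q B else 0) * s ^ (CARD('n) - i) * t ^ i)"
    proof (rule sum.cong)
      fix B assume B: "B \<in> F"
      have "card (VB B) > 0" "card (WB B) > 0" using ne VW B by (auto simp: card_gt_0_iff)
      then have j: "card (WB B) - 1 \<le> CARD('n)" "CARD('n) - (card (WB B) - 1) = card (VB B) - 1"
        using card[OF B] by auto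
      have "(\<Sum>i\<le>CARD('n). (if card (WB B) - 1 = i then q B else 0) * s ^ (CARD('n) - i) * t ^ i) =
          (\<Sum>i\<le>CARD('n). if i = card (WB B) - 1 then q B * s ^ (card (VB B) - 1) * t ^ i else 0)"
        by (rule sum.cong) (use j in auto)
      then show "s ^ (card (VB B) - 1) * t ^ (card (WB B) - 1) * q B = (\<Sum>i\<le>CARD('n).
          (if card (WB B) - 1 = i then q B else 0) * s ^ (CARD('n) - i) * t ^ i)"
        using j(1) by simp
    qed simp
    also have "\<dots> = (\<Sum>i\<le>CARD('n). a i * s ^ (CARD('n) - i) * t ^ i)"
      unfolding a_def sum_distrib_right by (rule sum.swap)
    finally show ?thesis unfolding P_def .
  qed
  ultimately show ?thesis by blast
qed

section \<open>The Steiner formula for convex bodies\<close>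

lemma scaleR_image_set_plus:
  fixes A B :: "'a::real_vector set"
  shows "(*\<^sub>R) r ` (A + B) = (*\<^sub>R) r ` A + (*\<^sub>R) r ` B"
proof
  show "(*\<^sub>R) r ` (A + B) \<subseteq> (*\<^sub>R) r ` A + (*\<^sub>R) r ` B"
  proof clarify
    fix x assume "x \<in> A + B"
    then obtain a b where "a \<in> A" "b \<in> B" "x = a + b" by (rule set_plus_elim)
    then show "r *\<^sub>R x \<in> (*\<^sub>R) r ` A + (*\<^sub>R) r ` B"
      by (simp only: scaleR_right_distrib set_plus_intro imageI)
  qed
  show "(*\<^sub>R) r ` A + (*\<^sub>R) r ` B \<subseteq> (*\<^sub>R) r ` (A + B)"
    by (auto elim!: set_plus_elim simp: scaleR_right_distrib[symmetric])
qed

lemma scaleR_image_scaleR_image: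
  fixes A :: "'a::real_vector set"
  shows "(*\<^sub>R) r ` (*\<^sub>R) s ` A = (*\<^sub>R) (r * s) ` A"
  by (simp add: image_image)

text \<open>Convexity gives the nontrivial inclusion: \<open>a *\<^sub>R x + b *\<^sub>R y\<close>
  is \<open>a + b\<close> times a convex combination.\<close>

lemma scaleR_image_add_convex:
  fixes C :: "'a::real_vector set"
  assumes "convex C" "0 \<le> a" "0 \<le> b"
  shows "(*\<^sub>R) (a + b) ` C = (*\<^sub>R) a ` C + (*\<^sub>R) b ` C"
proof
  show "(*\<^sub>R) (a + b) ` C \<subseteq> (*\<^sub>R) a ` C + (*\<^sub>R) b ` C"
    by (auto simp: scaleR_left_distrib)
  show "(*\<^sub>R) a ` C + (*\<^sub>R) b ` C \<subseteq> (*\<^sub>R) (a + b) ` C"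
  proof
    fix z assume "z \<in> (*\<^sub>R) a ` C + (*\<^sub>R) b ` C"
    then obtain x y where xy: "x \<in> C" "y \<in> C" "z = a *\<^sub>R x + b *\<^sub>R y"
      by (auto elim!: set_plus_elim)
    show "z \<in> (*\<^sub>R) (a + b) ` C"
    proof (cases "a + b = 0")
      case True
      then have "a = 0" "b = 0" using assms by auto
      with xy show ?thesis by auto
    next
      case False
      then have pos: "0 < a + b" using assms by simp
      define w where "w = (a / (a + b)) *\<^sub>R x + (b / (a + b)) *\<^sub>R y"
      have "w \<in> C"
        unfolding w_def using assms pos xy
        by (intro convexD) (auto simp: add_divide_distrib[symmetric])
      moreover have "z = (a + b) *\<^sub>R w"
        unfolding w_def xy(3) using pos by (simp add: scaleR_right_distrib)
      ultimately show ?thesis by blast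
    qed
  qed
qed

lemma measure_mono_compact:
  fixes A B :: "'a::euclidean_space set"
  assumes "compact A" "compact B" "A \<subseteq> B"
  shows "measure lebesgue A \<le> measure lebesgue B"
  using assms by (intro measure_mono_fmeasurable) (auto intro: lmeasurable_compact fmeasurableD)

lemma measure_translate:
  fixes A :: "'a::euclidean_space set"
  shows "measure lebesgue ({a} + A) = measure lebesgue A"
  by (simp add: translation_eq_singleton_plus[symmetric] measure_translation)

text \<open>The hull of \<open>G\<close> acts as a polytopal unit ball. Adding its
  \<open>e\<close>-dilate to the hull of a fine finite net of \<open>M\<close> covers
  \<open>M\<close>, and the result is again the hull of a finite set.\<close>

lemma outer_polytope:
  fixes M :: "'a::euclidean_space set"
  assumes M: "compact M" "convex M" and G: "finite G" "0 \<in> interior (convex hull G)" and e: "0 < e"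
  obtains F where "finite F" "M \<subseteq> convex hull F"
    "convex hull F \<subseteq> M + (*\<^sub>R) e ` (convex hull G)"
proof -
  obtain \<rho> where \<rho>: "0 < \<rho>" "ball 0 \<rho> \<subseteq> convex hull G"
    using G(2) by (auto simp: mem_interior)
  have "M \<subseteq> (\<Union>x\<in>M. ball x (e * \<rho>))" using e \<rho> by auto
  then obtain K where K: "K \<subseteq> M" "finite K" "M \<subseteq> (\<Union>x\<in>K. ball x (e * \<rho>))"
    using compactE_image[OF M(1), of M "\<lambda>x. ball x (e * \<rho>)"] by blast
  define F where "F = K + (*\<^sub>R) e ` G"
  have hull: "convex hull F = convex hull K + (*\<^sub>R) e ` (convex hull G)"
    unfolding F_def by (simp add: convex_hull_set_plus convex_hull_scaling)
  show thesis
  proof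
    show "finite F" unfolding F_def using K G by (simp add: finite_set_plus)
    show "M \<subseteq> convex hull F"
    proof
      fix x assume "x \<in> M"
      then obtain y where y: "y \<in> K" "dist y x < e * \<rho>" using K(3) by auto
      have "norm ((x - y) /\<^sub>R e) = norm (x - y) / e" using e by (simp add: divide_inverse)
      then have "(x - y) /\<^sub>R e \<in> ball 0 \<rho>"
        using y(2) e unfolding mem_ball_0
        by (simp add: dist_norm norm_minus_commute pos_divide_less_eq mult.commute)
      then have "e *\<^sub>R ((x - y) /\<^sub>R e) \<in> (*\<^sub>R) e ` (convex hull G)" using \<rho> by blast
      moreover have "y \<in> convex hull K" using y by (simp add: hull_inc)
      ultimately have "y + e *\<^sub>R ((x - y) /\<^sub>R e) \<in> convex hull F" unfolding hull by blast
      then show "x \<in> convex hull F" using e by simp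
    qed
    have "convex hull K \<subseteq> M" using K M by (simp add: hull_minimal)
    then show "convex hull F \<subseteq> M + (*\<^sub>R) e ` (convex hull G)"
      unfolding hull by (rule set_plus_mono2) simp
  qed
qed

lemma full_dimensional_inner_polytope:
  fixes E :: "'a::euclidean_space set"
  assumes "convex E" "aff_dim E = int (DIM('a))"
  obtains e0 and G :: "'a set" where "finite G" "0 \<in> interior (convex hull G)"
    "{e0} + convex hull G \<subseteq> E"
proof -
  have "affine hull E = UNIV" using assms(2) aff_dim_eq_full by blast
  then have "rel_interior E = interior E" by (rule rel_interior_interior)
  moreover have "E \<noteq> {}" using assms(2) by auto
  ultimately have "interior E \<noteq> {}" using rel_interior_eq_empty[OF assms(1)] by simp
  then obtain e0 where "e0 \<in> interior E" by blast
  then obtain r where r: "0 < r" "cball e0 r \<subseteq> E" by (auto simp: mem_interior_cball)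
  \<comment> \<open>Half the edge of a cube that fits into the ball of radius \<open>r\<close>, as
    the norm is at most the sum of the absolute coordinates.\<close>
  define d where "d = r / DIM('a)"
  have d: "0 < d" using r by (simp add: d_def)
  obtain G :: "'a set" where G: "finite G"
    "cbox (0 - (\<Sum>i\<in>Basis. d *\<^sub>R i)) (0 + (\<Sum>i\<in>Basis. d *\<^sub>R i)) = convex hull G"
    using cube_convex_hull[OF d, of 0] by blast
  have "0 \<in> box (0 - (\<Sum>i\<in>Basis. d *\<^sub>R i)) (0 + (\<Sum>i\<in>Basis. d *\<^sub>R i) :: 'a)"
    using d by (simp add: mem_box inner_sum_left_Basis)
  then have "0 \<in> interior (convex hull G)"
    unfolding G(2)[symmetric] interior_cbox .
  moreover have "{e0} + convex hull G \<subseteq> E"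
  proof
    fix z assume "z \<in> {e0} + convex hull G"
    then obtain x where x: "x \<in> convex hull G" "z = e0 + x" by (auto elim!: set_plus_elim)
    have "norm x \<le> (\<Sum>i\<in>Basis. \<bar>x \<bullet> i\<bar>)" by (rule norm_le_l1)
    also have "\<dots> \<le> (\<Sum>i\<in>(Basis :: 'a set). d)"
      using x(1) unfolding G(2)[symmetric]
      by (intro sum_mono) (auto simp: mem_box inner_sum_left_Basis abs_le_iff minus_le_iff)
    also have "\<dots> = r" by (simp add: d_def)
    finally have "z \<in> cball e0 r" unfolding x(2) by (simp add: dist_norm)
    then show "z \<in> E" using r by blast
  qed
  ultimately show thesis using that G(1) by blast
qed

lemma compact_minkowski_combination:
  fixes M E :: "'a::real_normed_vector set"
  assumes "compact M" "compact E"
  shows "compact (M + (*\<^sub>R) t ` E)"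
  using assms by (intro compact_set_plus compact_scaling)

text \<open>A translate of \<open>M\<close> by \<open>\<delta> *\<^sub>R m\<close> lies in the
  dilate of \<open>M\<close> by \<open>1 + \<delta>\<close>, so a translate of the larger sum fits
  into the dilate of the smaller one.\<close>

lemma volume_minkowski_growth:
  fixes M E :: "(real ^ 'n) set"
  assumes M: "convex_body M" and E: "convex_body E" and "0 \<le> t" "0 \<le> \<delta>"
  shows "vol (M + (*\<^sub>R) ((1 + \<delta>) * t) ` E) \<le> (1 + \<delta>) ^ CARD('n) * vol (M + (*\<^sub>R) t ` E)"
proof -
  note cb = M[unfolded convex_body_def] E[unfolded convex_body_def]
  obtain m where m: "m \<in> M" using cb by blast
  have "{\<delta> *\<^sub>R m} + M \<subseteq> (*\<^sub>R) \<delta> ` M + (*\<^sub>R) 1 ` M" using m by (intro set_plus_mono2) auto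
  also have "\<dots> = (*\<^sub>R) (1 + \<delta>) ` M"
    using scaleR_image_add_convex[of M \<delta> 1] cb assms by (simp add: add.commute)
  finally have "{\<delta> *\<^sub>R m} + (M + (*\<^sub>R) ((1 + \<delta>) * t) ` E) \<subseteq>
      (*\<^sub>R) (1 + \<delta>) ` M + (*\<^sub>R) (1 + \<delta>) ` (*\<^sub>R) t ` E"
    unfolding scaleR_image_scaleR_image add.assoc[symmetric] by (rule set_plus_mono2) simp
  also have "\<dots> = (*\<^sub>R) (1 + \<delta>) ` (M + (*\<^sub>R) t ` E)" by (simp add: scaleR_image_set_plus)
  finally have "vol ({\<delta> *\<^sub>R m} + (M + (*\<^sub>R) ((1 + \<delta>) * t) ` E)) \<le> vol ((*\<^sub>R) (1 + \<delta>) ` (M + (*\<^sub>R) t ` E))"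
    using cb
    by (intro measure_mono_compact compact_set_plus compact_scaling compact_minkowski_combination) auto
  then show ?thesis using assms by (simp add: measure_translate measure_scale)
qed

text \<open>Bolzano-Weierstrass, passing to a further subsequence for each index.\<close>

lemma bounded_coefficients_subsequence:
  fixes a :: "nat \<Rightarrow> 'b \<Rightarrow> real"
  assumes "finite I" "\<And>k i. i \<in> I \<Longrightarrow> a k i \<in> {0..C}"
  shows "\<exists>r l. strict_mono (r :: nat \<Rightarrow> nat) \<and> (\<forall>i\<in>I. (\<lambda>k. a (r k) i) \<longlonglongrightarrow> l i)"
  using assms
proof (induction I rule: finite_induct)
  case empty
  show ?case using strict_mono_id by auto
next
  case (insert j I)
  then obtain r l where r: "strict_mono r" "\<forall>i\<in>I. (\<lambda>k. a (r k) i) \<longlonglongrightarrow> l i" by auto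
  have "\<forall>k. a (r k) j \<in> {0..C}" using insert.prems by blast
  moreover have "seq_compact {0..C}" by (simp add: compact_imp_seq_compact)
  ultimately obtain x s where s: "strict_mono s" "((\<lambda>k. a (r k) j) \<circ> s) \<longlonglongrightarrow> x"
    unfolding seq_compact_def by (metis (no_types, lifting))
  have "(\<lambda>k. a ((r \<circ> s) k) i) \<longlonglongrightarrow> (l(j := x)) i" if "i \<in> insert j I" for i
  proof (cases "i = j")
    case True
    then show ?thesis using s(2) by (simp add: comp_def)
  next
    case False
    then show ?thesis
      using that r(2) LIMSEQ_subseq_LIMSEQ[OF _ s(1), of "\<lambda>k. a (r k) i" "l i"]
      by (simp add: comp_def)
  qed
  moreover have "strict_mono (r \<circ> s)" using r s by (simp add: strict_mono_o)
  ultimately show ?case by blast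
qed

text \<open>Outer polytopes give polynomials with nonnegative coefficients squeezed between
  \<open>f t\<close> and a multiple of \<open>f t\<close> whose factor tends to 1. The coefficients
  are bounded by the values at 1, so a subsequence converges, and the limit polynomial must be
  \<open>f\<close>.\<close>

lemma steiner_formula_nonneg:
  fixes M E :: "(real ^ 'n) set"
  assumes M: "convex_body M" and E: "convex_body E" and dim: "aff_dim E = int CARD('n)"
  obtains a where "\<And>i. 0 \<le> a i"
    "\<And>t. 0 < t \<Longrightarrow> vol (M + (*\<^sub>R) t ` E) = (\<Sum>i\<le>CARD('n). a i * t ^ i)"
proof -
  define f where "f t = vol (M + (*\<^sub>R) t ` E)" for t
  note cb = M[unfolded convex_body_def] E[unfolded convex_body_def]
  obtain e0 and G :: "(real ^ 'n) set" where G: "finite G" "0 \<in> interior (convex hull G)"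
    "{e0} + convex hull G \<subseteq> E"
    using full_dimensional_inner_polytope[of E] cb dim by (metis DIM_cart DIM_real mult.right_neutral)
  have approx: "\<exists>b. (\<forall>i. 0 \<le> b i) \<and> (\<forall>t>0. f t \<le> (\<Sum>i\<le>CARD('n). b i * t ^ i) \<and>
      (\<Sum>i\<le>CARD('n). b i * t ^ i) \<le> (1 + e * (1 + t) / t) ^ CARD('n) * f t)"
    if e: "0 < e" for e :: real
  proof -
    obtain V where V: "finite V" "M \<subseteq> convex hull V" "convex hull V \<subseteq> M + (*\<^sub>R) e ` (convex hull G)"
      using outer_polytope[OF _ _ G(1,2) e, of M] cb by blast
    obtain W where W: "finite W" "E \<subseteq> convex hull W" "convex hull W \<subseteq> E + (*\<^sub>R) e ` (convex hull G)"
      using outer_polytope[OF _ _ G(1,2) e, of E] cb by blast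
    obtain b where b: "\<And>i. 0 \<le> b i" "\<And>s t. 0 < s \<Longrightarrow> 0 < t \<Longrightarrow>
        vol ((*\<^sub>R) s ` (convex hull V) + (*\<^sub>R) t ` (convex hull W)) =
        (\<Sum>i\<le>CARD('n). b i * s ^ (CARD('n) - i) * t ^ i)"
      using polytope_steiner[OF V(1) W(1)] by blast
    have "f t \<le> (\<Sum>i\<le>CARD('n). b i * t ^ i) \<and>
        (\<Sum>i\<le>CARD('n). b i * t ^ i) \<le> (1 + e * (1 + t) / t) ^ CARD('n) * f t" if t: "0 < t" for t
    proof -
      define P where "P = convex hull V + (*\<^sub>R) t ` (convex hull W)"
      have P: "vol P = (\<Sum>i\<le>CARD('n). b i * t ^ i)"
        using b(2)[of 1 t] t by (simp add: P_def)
      have "compact P" unfolding P_def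
        using V W by (intro compact_minkowski_combination) (simp_all add: finite_imp_compact_convex_hull)
      \<comment> \<open>Chosen so that \<open>\<delta> * t = e + t * e\<close>, the total thickening
        coming from \<open>M\<close> and from \<open>t\<close> times \<open>E\<close>.\<close>
      define \<delta> where "\<delta> = e * (1 + t) / t"
      have \<delta>: "0 \<le> \<delta>" "\<delta> * t = e + t * e" using e t by (auto simp: \<delta>_def field_simps)
      have "M + (*\<^sub>R) t ` E \<subseteq> P"
        unfolding P_def using V W by (intro set_plus_mono2 image_mono)
      then have "vol (M + (*\<^sub>R) t ` E) \<le> vol P"
        using cb \<open>compact P\<close> by (intro measure_mono_compact compact_minkowski_combination) auto
      moreover have "vol P \<le> (1 + \<delta>) ^ CARD('n) * f t"
      proof -
        let ?C = "convex hull G"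
        have "P \<subseteq> (M + (*\<^sub>R) e ` ?C) + (*\<^sub>R) t ` (E + (*\<^sub>R) e ` ?C)"
          unfolding P_def using V W by (intro set_plus_mono2 image_mono)
        also have "\<dots> = (M + (*\<^sub>R) t ` E) + ((*\<^sub>R) e ` ?C + (*\<^sub>R) (t * e) ` ?C)"
          by (simp add: scaleR_image_set_plus scaleR_image_scaleR_image ac_simps)
        also have "\<dots> = (M + (*\<^sub>R) t ` E) + (*\<^sub>R) (\<delta> * t) ` ?C"
          using e t by (simp add: \<delta> scaleR_image_add_convex)
        \<comment> \<open>Translating by \<open>(\<delta> * t) *\<^sub>R e0\<close> allows the
          dilated hull of \<open>G\<close> to be replaced by a dilate of \<open>E\<close>.\<close>
        finally have "{(\<delta> * t) *\<^sub>R e0} + P \<subseteq> {(\<delta> * t) *\<^sub>R e0} + ((M + (*\<^sub>R) t ` E) + (*\<^sub>R) (\<delta> * t) ` ?C)"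
          by (intro set_plus_mono2) auto
        also have "\<dots> = (M + (*\<^sub>R) t ` E) + (*\<^sub>R) (\<delta> * t) ` ({e0} + ?C)"
          by (simp add: scaleR_image_set_plus ac_simps)
        also have "\<dots> \<subseteq> (M + (*\<^sub>R) t ` E) + (*\<^sub>R) (\<delta> * t) ` E"
          using G by (intro set_plus_mono2 image_mono) auto
        also have "\<dots> = M + (*\<^sub>R) ((1 + \<delta>) * t) ` E"
          using scaleR_image_add_convex[of E t "\<delta> * t"] cb t \<delta>(1)
          by (simp add: add.assoc distrib_right)
        finally have "vol ({(\<delta> * t) *\<^sub>R e0} + P) \<le> vol (M + (*\<^sub>R) ((1 + \<delta>) * t) ` E)"
          using cb \<open>compact P\<close>
          by (intro measure_mono_compact compact_set_plus compact_minkowski_combination) auto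
        also have "\<dots> \<le> (1 + \<delta>) ^ CARD('n) * f t"
          unfolding f_def using M E t \<delta>(1) by (intro volume_minkowski_growth) auto
        finally show ?thesis by (simp add: measure_translate)
      qed
      ultimately show ?thesis unfolding f_def \<delta>_def P by blast
    qed
    with b(1) show ?thesis by blast
  qed
  define e where "e k = 1 / (real k + 1)" for k
  have e: "0 < e k" "e k \<le> 1" for k by (auto simp: e_def field_simps)
  have "\<exists>b. \<forall>k. (\<forall>i. 0 \<le> b k i) \<and> (\<forall>t>0. f t \<le> (\<Sum>i\<le>CARD('n). b k i * t ^ i) \<and>
      (\<Sum>i\<le>CARD('n). b k i * t ^ i) \<le> (1 + e k * (1 + t) / t) ^ CARD('n) * f t)"
    using approx[OF e(1)] by (intro choice allI)
  then obtain b where b: "\<And>k i. 0 \<le> b k i"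
    "\<And>k t. 0 < t \<Longrightarrow> f t \<le> (\<Sum>i\<le>CARD('n). b k i * t ^ i)"
    "\<And>k t. 0 < t \<Longrightarrow> (\<Sum>i\<le>CARD('n). b k i * t ^ i) \<le> (1 + e k * (1 + t) / t) ^ CARD('n) * f t"
    by blast
  \<comment> \<open>At \<open>t = 1\<close> the factor is \<open>(1 + 2 * e k) ^ CARD('n)\<close>,
    at most \<open>3 ^ CARD('n)\<close> since \<open>e k\<close> is at most 1.\<close>
  have "b k i \<in> {0..3 ^ CARD('n) * f 1}" if "i \<in> {..CARD('n)}" for k i
  proof -
    have "b k i \<le> (\<Sum>i\<le>CARD('n). b k i)" using that b(1) by (intro member_le_sum) auto
    also have "\<dots> \<le> (1 + e k * 2) ^ CARD('n) * f 1" using b(3)[of 1 k] by simp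
    also have "\<dots> \<le> 3 ^ CARD('n) * f 1"
      using e[of k] by (intro mult_right_mono power_mono) (auto simp: f_def)
    finally show ?thesis using b(1) by simp
  qed
  then obtain r a where r: "strict_mono (r :: nat \<Rightarrow> nat)"
    and a: "\<forall>i\<in>{..CARD('n)}. (\<lambda>k. b (r k) i) \<longlonglongrightarrow> a i"
    using bounded_coefficients_subsequence[of "{..CARD('n)}" b "3 ^ CARD('n) * f 1"] by auto
  \<comment> \<open>The limits are controlled only up to n; the value 0 beyond gives nonnegativity
    at every index.\<close>
  define a' where "a' i = (if i \<le> CARD('n) then a i else 0)" for i
  have "0 \<le> a' i" for i
  proof (cases "i \<le> CARD('n)")
    case True
    then have "(\<lambda>k. b (r k) i) \<longlonglongrightarrow> a i" using a by simp
    then have "0 \<le> a i" by (rule LIMSEQ_le_const) (use b(1) in auto)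
    then show ?thesis by (simp add: a'_def)
  qed (simp add: a'_def)
  moreover have "f t = (\<Sum>i\<le>CARD('n). a' i * t ^ i)" if t: "0 < t" for t
  proof -
    have "(\<lambda>k. \<Sum>i\<le>CARD('n). b (r k) i * t ^ i) \<longlonglongrightarrow> (\<Sum>i\<le>CARD('n). a i * t ^ i)"
      using a by (intro tendsto_intros) auto
    moreover have "(\<lambda>k. \<Sum>i\<le>CARD('n). b (r k) i * t ^ i) \<longlonglongrightarrow> f t"
    proof (rule tendsto_sandwich[OF always_eventually always_eventually])
      show "(\<lambda>k. f t) \<longlonglongrightarrow> f t" by simp
      have "e \<longlonglongrightarrow> 0" unfolding e_def using LIMSEQ_inverse_real_of_nat
        by (simp add: inverse_eq_divide add.commute)
      then have "(\<lambda>k. e (r k)) \<longlonglongrightarrow> 0" using LIMSEQ_subseq_LIMSEQ[OF _ r] by (simp add: comp_def)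
      then have "(\<lambda>k. (1 + e (r k) * (1 + t) / t) ^ CARD('n) * f t) \<longlonglongrightarrow> (1 + 0 * (1 + t) / t) ^ CARD('n) * f t"
        using t by (intro tendsto_intros) auto
      then show "(\<lambda>k. (1 + e (r k) * (1 + t) / t) ^ CARD('n) * f t) \<longlonglongrightarrow> f t" by simp
    qed (use b(2,3) t in auto)
    ultimately have "f t = (\<Sum>i\<le>CARD('n). a i * t ^ i)" using LIMSEQ_unique by blast
    then show ?thesis by (simp add: a'_def)
  qed
  ultimately show thesis using that unfolding f_def by blast
qed

section \<open>Vanishing of the low-order coefficients\<close>

text \<open>Homogeneity of volume reverses the polynomial, so that the low coefficients govern the
  growth in \<open>s\<close>.\<close>

lemma volume_scaled_add:
  fixes M E :: "(real ^ 'n) set"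
  assumes s: "0 < s"
    and a: "\<And>t. 0 < t \<Longrightarrow> vol (M + (*\<^sub>R) t ` E) = (\<Sum>i\<le>CARD('n). a i * t ^ i)"
  shows "vol ((*\<^sub>R) s ` M + E) = (\<Sum>i\<le>CARD('n). a i * s ^ (CARD('n) - i))"
proof -
  have "(*\<^sub>R) s ` M + E = (*\<^sub>R) s ` (M + (*\<^sub>R) (1 / s) ` E)"
    using s by (simp add: scaleR_image_set_plus scaleR_image_scaleR_image)
  then have "vol ((*\<^sub>R) s ` M + E) = s ^ CARD('n) * (\<Sum>i\<le>CARD('n). a i * (1 / s) ^ i)"
    using a[of "1 / s"] s measure_scale[of s "M + (*\<^sub>R) (1 / s) ` E"] by simp
  also have "\<dots> = (\<Sum>i\<le>CARD('n). a i * s ^ (CARD('n) - i))"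
    unfolding sum_distrib_left using s
    by (intro sum.cong) (auto simp: power_diff power_one_over field_simps)
  finally show ?thesis .
qed

text \<open>Let \<open>s\<close> tend to 0 in \<open>volume_scaled_add\<close>. A translate of
  \<open>M\<close> lies in a dilate of \<open>E\<close>, which squeezes the volume between
  \<open>vol E\<close> and \<open>(s * \<kappa> + 1) ^ CARD('n) * vol E\<close>.\<close>

lemma steiner_leading_coefficient:
  fixes M E :: "(real ^ 'n) set"
  assumes M: "convex_body M" and E: "convex_body E" and dim: "aff_dim E = int CARD('n)"
    and a: "\<And>t. 0 < t \<Longrightarrow> vol (M + (*\<^sub>R) t ` E) = (\<Sum>i\<le>CARD('n). a i * t ^ i)"
  shows "vol E = a CARD('n)"
proof -
  note cb = M[unfolded convex_body_def] E[unfolded convex_body_def]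
  obtain e0 and G :: "(real ^ 'n) set" where G: "finite G" "0 \<in> interior (convex hull G)"
    "{e0} + convex hull G \<subseteq> E"
    using full_dimensional_inner_polytope[of E] cb dim by (metis DIM_cart DIM_real mult.right_neutral)
  obtain \<rho> where \<rho>: "0 < \<rho>" "ball 0 \<rho> \<subseteq> convex hull G"
    using G(2) by (auto simp: mem_interior)
  obtain R where R: "0 < R" "\<And>x. x \<in> M \<Longrightarrow> norm x < R"
    using cb compact_imp_bounded bounded_pos_less by metis
  \<comment> \<open>Shrinking by this factor brings \<open>M\<close> into the ball of radius
    \<open>\<rho>\<close>, which fits into \<open>E\<close> around \<open>e0\<close>.\<close>
  define \<kappa> where "\<kappa> = R / \<rho>"
  have \<kappa>: "0 < \<kappa>" using R \<rho> by (simp add: \<kappa>_def)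
  have M_sub: "{\<kappa> *\<^sub>R e0} + M \<subseteq> (*\<^sub>R) \<kappa> ` E"
  proof
    fix z assume "z \<in> {\<kappa> *\<^sub>R e0} + M"
    then obtain x where x: "x \<in> M" "z = \<kappa> *\<^sub>R e0 + x" by (auto elim!: set_plus_elim)
    have "norm (x /\<^sub>R \<kappa>) = norm x / \<kappa>" using \<kappa> by (simp add: divide_inverse)
    also have "\<dots> < \<rho>" using R(2)[OF x(1)] R(1) \<rho>(1) by (simp add: \<kappa>_def field_simps)
    finally have "x /\<^sub>R \<kappa> \<in> convex hull G" using \<rho>(2) by (auto simp: dist_norm)
    then have "e0 + x /\<^sub>R \<kappa> \<in> E" using G(3) by auto
    moreover have "z = \<kappa> *\<^sub>R (e0 + x /\<^sub>R \<kappa>)" using \<kappa> unfolding x(2) by (simp add: scaleR_right_distrib)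
    ultimately show "z \<in> (*\<^sub>R) \<kappa> ` E" by blast
  qed
  obtain m where m: "m \<in> M" using cb by blast
  have bounds: "vol E \<le> vol ((*\<^sub>R) s ` M + E) \<and> vol ((*\<^sub>R) s ` M + E) \<le> (s * \<kappa> + 1) ^ CARD('n) * vol E"
    if s: "0 < s" for s
  proof
    have comp: "compact ((*\<^sub>R) s ` M + E)"
      using cb by (intro compact_set_plus compact_scaling) auto
    have "{s *\<^sub>R m} + E \<subseteq> (*\<^sub>R) s ` M + E" using m by (intro set_plus_mono2) auto
    then have "vol ({s *\<^sub>R m} + E) \<le> vol ((*\<^sub>R) s ` M + E)"
      using cb comp compact_set_plus[of "{s *\<^sub>R m}" E] by (intro measure_mono_compact) auto
    then show "vol E \<le> vol ((*\<^sub>R) s ` M + E)" by (simp add: measure_translate)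
    have "{s *\<^sub>R (\<kappa> *\<^sub>R e0)} + ((*\<^sub>R) s ` M + E) = (*\<^sub>R) s ` ({\<kappa> *\<^sub>R e0} + M) + E"
      by (simp add: scaleR_image_set_plus add.assoc)
    also have "\<dots> \<subseteq> (*\<^sub>R) s ` (*\<^sub>R) \<kappa> ` E + (*\<^sub>R) 1 ` E"
      using M_sub by (intro set_plus_mono2 image_mono) auto
    also have "\<dots> = (*\<^sub>R) (s * \<kappa> + 1) ` E"
      using scaleR_image_add_convex[of E "s * \<kappa>" 1] cb s \<kappa> by (simp add: scaleR_image_scaleR_image)
    finally have "vol ({s *\<^sub>R (\<kappa> *\<^sub>R e0)} + ((*\<^sub>R) s ` M + E)) \<le> vol ((*\<^sub>R) (s * \<kappa> + 1) ` E)"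
      using cb comp by (intro measure_mono_compact compact_set_plus compact_scaling) auto
    then show "vol ((*\<^sub>R) s ` M + E) \<le> (s * \<kappa> + 1) ^ CARD('n) * vol E"
      using s \<kappa> by (simp add: measure_translate measure_scale)
  qed
  define s where "s k = 1 / real (Suc k)" for k
  have s: "0 < s k" for k by (simp add: s_def)
  have s0: "s \<longlonglongrightarrow> 0" unfolding s_def using LIMSEQ_inverse_real_of_nat by (simp add: inverse_eq_divide)
  have "(\<lambda>k. \<Sum>i\<le>CARD('n). a i * s k ^ (CARD('n) - i)) \<longlonglongrightarrow> (\<Sum>i\<le>CARD('n). a i * 0 ^ (CARD('n) - i))"
    using s0 by (intro tendsto_intros)
  also have "(\<Sum>i\<le>CARD('n). a i * 0 ^ (CARD('n) - i)) = (\<Sum>i\<le>CARD('n). if i = CARD('n) then a i else 0)"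
    by (rule sum.cong) auto
  also have "\<dots> = a CARD('n)" by simp
  finally have "(\<lambda>k. vol ((*\<^sub>R) (s k) ` M + E)) \<longlonglongrightarrow> a CARD('n)"
    by (simp add: volume_scaled_add[OF s a])
  moreover have "(\<lambda>k. vol ((*\<^sub>R) (s k) ` M + E)) \<longlonglongrightarrow> vol E"
  proof (rule tendsto_sandwich[OF always_eventually always_eventually])
    show "(\<lambda>k. vol E) \<longlonglongrightarrow> vol E" by simp
    have "(\<lambda>k. (s k * \<kappa> + 1) ^ CARD('n) * vol E) \<longlonglongrightarrow> (0 * \<kappa> + 1) ^ CARD('n) * vol E"
      using s0 by (intro tendsto_intros)
    then show "(\<lambda>k. (s k * \<kappa> + 1) ^ CARD('n) * vol E) \<longlonglongrightarrow> vol E" by simp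
  qed (use bounds[OF s] in auto)
  ultimately show ?thesis using LIMSEQ_unique by blast
qed

text \<open>A dilated segment is covered by translates of the segment itself, so the volume grows at most
  linearly in the dilation factor.\<close>

lemma volume_segment_growth:
  fixes M E :: "(real ^ 'n) set"
  assumes M: "convex_body M" and E: "convex_body E" and dim: "aff_dim M \<le> 1" and k: "0 < k"
  shows "vol ((*\<^sub>R) (real k) ` M + E) \<le> real k * vol (M + E)"
proof -
  note cb = M[unfolded convex_body_def] E[unfolded convex_body_def]
  have "collinear M" using dim by (simp add: collinear_aff_dim)
  then obtain p q where pq: "M = closed_segment p q"
    using compact_convex_collinear_segment cb by metis
  \<comment> \<open>The dilated segment starts at \<open>real k *\<^sub>R p\<close>; the translate
    by \<open>c j\<close> is its piece number \<open>j\<close>, counted from 0.\<close>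
  define c where "c j = (real k - 1) *\<^sub>R p + real j *\<^sub>R (q - p)" for j
  have "(*\<^sub>R) (real k) ` M \<subseteq> (\<Union>j<k. {c j} + M)"
  proof clarify
    fix x assume "x \<in> M"
    then obtain u where u: "0 \<le> u" "u \<le> 1" "x = p + u *\<^sub>R (q - p)"
      unfolding pq closed_segment_def by (auto simp: algebra_simps)
    define l where "l = nat \<lfloor>k * u\<rfloor>"
    \<comment> \<open>For \<open>u = 1\<close> the floor is \<open>k\<close>, one past the last
      piece, hence the minimum.\<close>
    define j where "j = min l (k - 1)"
    have l: "real l \<le> k * u" "k * u < real l + 1" using u k by (auto simp: l_def of_nat_nat)
    have "k * u \<le> k" using u by (simp add: mult_left_le)
    then have "0 \<le> k * u - j" "k * u - j \<le> 1"
      using l k by (auto simp: j_def min_def of_nat_diff)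
    then have "p + (k * u - j) *\<^sub>R (q - p) \<in> M"
      unfolding pq closed_segment_def by (auto intro!: exI[of _ "k * u - j"] simp: algebra_simps)
    moreover have "real k *\<^sub>R x = c j + (p + (k * u - j) *\<^sub>R (q - p))"
      unfolding u(3) c_def by (simp add: algebra_simps)
    moreover have "j < k" using k by (simp add: j_def)
    ultimately show "real k *\<^sub>R x \<in> (\<Union>j<k. {c j} + M)" by auto
  qed
  then have "(*\<^sub>R) (real k) ` M + E \<subseteq> (\<Union>j<k. {c j} + M) + E" by (intro set_plus_mono2) auto
  also have "\<dots> = (\<Union>j<k. {c j} + (M + E))"
    unfolding add.assoc[symmetric] by (auto simp: set_plus_def)
  finally have "(*\<^sub>R) (real k) ` M + E \<subseteq> (\<Union>j<k. {c j} + (M + E))" .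
  moreover have comp: "compact ({c j} + (M + E))" "compact ((*\<^sub>R) (real k) ` M + E)" for j
    using cb by (auto intro!: compact_set_plus compact_scaling)
  ultimately have "vol ((*\<^sub>R) (real k) ` M + E) \<le> vol (\<Union>j<k. {c j} + (M + E))"
    by (intro measure_mono_compact compact_UN) auto
  also have "\<dots> \<le> (\<Sum>j<k. vol ({c j} + (M + E)))"
    using comp(1) by (intro measure_UNION_le) (auto intro: lmeasurable_compact fmeasurableD)
  also have "\<dots> = real k * vol (M + E)" by (simp add: measure_translate)
  finally show ?thesis .
qed

text \<open>Three non-collinear points give independent \<open>u\<close> and \<open>v\<close>, and
  an injective linear map is bounded below. The maximum is convenient because distinct integer pairs
  differ by at least 1 in some coordinate.\<close>

lemma affinely_independent_lattice_separation:
  fixes M :: "'a::euclidean_space set"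
  assumes "\<not> collinear M"
  obtains p u v \<beta> where "p \<in> M" "p + u \<in> M" "p + v \<in> M" "0 < \<beta>"
    "\<And>x y::real. \<beta> * max \<bar>x\<bar> \<bar>y\<bar> \<le> norm (x *\<^sub>R u + y *\<^sub>R v)"
proof -
  have "\<exists>p\<in>M. \<exists>q\<in>M. p \<noteq> q"
  proof (rule ccontr)
    assume "\<not> ?thesis"
    then have "collinear M" unfolding collinear_def
      by (intro exI[of _ 0] ballI) auto
    with assms show False by simp
  qed
  then obtain p q where pq: "p \<in> M" "q \<in> M" "p \<noteq> q" by blast
  define u where "u = q - p"
  have "\<exists>r\<in>M. \<forall>c. r - p \<noteq> c *\<^sub>R u"
  proof (rule ccontr)
    assume "\<not> ?thesis"
    then have *: "\<exists>c. r - p = c *\<^sub>R u" if "r \<in> M" for r using that by blast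
    have "\<exists>c. x - y = c *\<^sub>R u" if "x \<in> M" "y \<in> M" for x y
    proof -
      obtain c d where "x - p = c *\<^sub>R u" "y - p = d *\<^sub>R u" using * \<open>x \<in> M\<close> \<open>y \<in> M\<close> by blast
      then have "x - y = (c - d) *\<^sub>R u" by (simp add: algebra_simps)
      then show ?thesis by blast
    qed
    then have "collinear M" unfolding collinear_def by blast
    with assms show False by simp
  qed
  then obtain r where r: "r \<in> M" "\<And>c. r - p \<noteq> c *\<^sub>R u" by blast
  define v where "v = r - p"
  define f where "f = (\<lambda>(x::real, y::real). x *\<^sub>R u + y *\<^sub>R v)"
  have "linear f" unfolding f_def by (rule linearI) (auto simp: algebra_simps)
  moreover have "inj f"
    unfolding linear_injective_0[OF \<open>linear f\<close>]
  proof clarify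
    fix x y assume "f (x, y) = 0"
    then have eq: "x *\<^sub>R u + y *\<^sub>R v = 0" by (simp add: f_def)
    have "y = 0"
    proof (rule ccontr)
      assume "y \<noteq> 0"
      have "y *\<^sub>R v = (- x) *\<^sub>R u" using eq by (simp add: eq_neg_iff_add_eq_0 add.commute)
      then have "inverse y *\<^sub>R (y *\<^sub>R v) = inverse y *\<^sub>R ((- x) *\<^sub>R u)" by simp
      then have "v = (- x / y) *\<^sub>R u" using \<open>y \<noteq> 0\<close> by (simp add: divide_inverse mult.commute)
      then show False using r(2) unfolding v_def by blast
    qed
    with eq pq(3) show "(x, y) = 0" by (simp add: u_def zero_prod_def)
  qed
  ultimately obtain \<beta> where \<beta>: "0 < \<beta>" "\<And>z. \<beta> * norm z \<le> norm (f z)"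
    using linear_inj_bounded_below_pos by metis
  show thesis
  proof
    show "p \<in> M" "p + u \<in> M" "p + v \<in> M" using pq r by (simp_all add: u_def v_def)
    show "0 < \<beta>" by fact
    fix x y :: real
    have "max \<bar>x\<bar> \<bar>y\<bar> \<le> norm (x, y)"
      using norm_fst_le[of x y] norm_snd_le[of y x] by simp
    then have "\<beta> * max \<bar>x\<bar> \<bar>y\<bar> \<le> \<beta> * norm (x, y)" using \<beta>(1) by (intro mult_left_mono) auto
    also have "\<dots> \<le> norm (x *\<^sub>R u + y *\<^sub>R v)" using \<beta>(2)[of "(x, y)"] by (simp add: f_def)
    finally show "\<beta> * max \<bar>x\<bar> \<bar>y\<bar> \<le> norm (x *\<^sub>R u + y *\<^sub>R v)" .
  qed
qed

text \<open>A dilated triangle contains quadratically many points of a lattice; balls around them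
  are disjoint.\<close>

lemma volume_planar_growth:
  fixes M E :: "(real ^ 'n) set"
  assumes M: "convex_body M" and E: "convex_body E" and dimE: "aff_dim E = int CARD('n)"
    and dimM: "\<not> aff_dim M \<le> 1"
  obtains c where "0 < c" "\<And>k::nat. 0 < k \<Longrightarrow> c * real k ^ 2 \<le> vol ((*\<^sub>R) (2 * real k) ` M + E)"
proof -
  note cb = M[unfolded convex_body_def] E[unfolded convex_body_def]
  obtain e0 and G :: "(real ^ 'n) set" where G: "finite G" "0 \<in> interior (convex hull G)"
    "{e0} + convex hull G \<subseteq> E"
    using full_dimensional_inner_polytope[of E] cb dimE by (metis DIM_cart DIM_real mult.right_neutral)
  obtain r where r: "0 < r" "ball 0 r \<subseteq> convex hull G"
    using G(2) by (auto simp: mem_interior)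
  have "\<not> collinear M" using dimM by (simp add: collinear_aff_dim)
  then obtain p u v \<beta> where puv: "p \<in> M" "p + u \<in> M" "p + v \<in> M" "0 < \<beta>"
    and sep: "\<And>x y::real. \<beta> * max \<bar>x\<bar> \<bar>y\<bar> \<le> norm (x *\<^sub>R u + y *\<^sub>R v)"
    by (rule affinely_independent_lattice_separation) blast
  \<comment> \<open>Below \<open>r\<close> the balls fit into \<open>E\<close>; below
    \<open>\<beta> / 2\<close> those around distinct lattice points are disjoint.\<close>
  define \<rho> where "\<rho> = min r (\<beta> / 2)"
  have \<rho>: "0 < \<rho>" "\<rho> \<le> r" "2 * \<rho> \<le> \<beta>" using r puv by (auto simp: \<rho>_def)
  have "vol (ball 0 \<rho> :: (real^'n) set) * real k ^ 2 \<le> vol ((*\<^sub>R) (2 * real k) ` M + E)"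
    if k: "0 < k" for k :: nat
  proof -
    \<comment> \<open>Dilating by \<open>2 * real k\<close> puts the whole \<open>k\<close> by
      \<open>k\<close> grid into the triangle, as \<open>i + j\<close> stays below
      \<open>2 * k\<close>.\<close>
    define z where "z = (\<lambda>(i, j). (2 * real k) *\<^sub>R p + real i *\<^sub>R u + real j *\<^sub>R v + e0)"
    define I where "I = {..<k} \<times> {..<k}"
    have sub: "ball (z (i, j)) \<rho> \<subseteq> (*\<^sub>R) (2 * real k) ` M + E" if ij: "i < k" "j < k" for i j
    proof
      fix x assume x: "x \<in> ball (z (i, j)) \<rho>"
      define y where "y = (1 - i / (2 * k) - j / (2 * k)) *\<^sub>R p + (i / (2 * k)) *\<^sub>R (p + u) + (j / (2 * k)) *\<^sub>R (p + v)"
      have "real i + real j \<le> 2 * real k" using ij by simp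
      then have "i / (2 * k) + j / (2 * k) \<le> (1::real)"
        using k by (simp add: add_divide_distrib[symmetric])
      then have "y \<in> convex hull {p, p + u, p + v}"
        unfolding y_def convex_hull_3 by (intro CollectI exI conjI refl) auto
      then have "y \<in> M" using puv cb hull_minimal[of "{p, p + u, p + v}" M convex] by auto
      moreover have "(2 * real k) *\<^sub>R y = (2 * real k) *\<^sub>R p + real i *\<^sub>R u + real j *\<^sub>R v"
        unfolding y_def using k by (simp add: algebra_simps)
      moreover have "x - z (i, j) \<in> convex hull G"
        using x r(2) \<rho>(2) by (auto simp: dist_norm norm_minus_commute)
      then have "e0 + (x - z (i, j)) \<in> E" using G(3) by auto
      moreover have "x = ((2 * real k) *\<^sub>R p + real i *\<^sub>R u + real j *\<^sub>R v) + (e0 + (x - z (i, j)))"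
        by (simp add: z_def)
      ultimately show "x \<in> (*\<^sub>R) (2 * real k) ` M + E"
        by (metis imageI set_plus_intro)
    qed
    have disj: "ball (z a) \<rho> \<inter> ball (z b) \<rho> = {}" if "a \<noteq> b" for a b
    proof -
      obtain i j i' j' where ab: "a = (i, j)" "b = (i', j')" by (metis surj_pair)
      have "1 \<le> max \<bar>real i - real i'\<bar> \<bar>real j - real j'\<bar>" using that unfolding ab by auto
      then have "\<beta> \<le> \<beta> * max \<bar>real i - real i'\<bar> \<bar>real j - real j'\<bar>" using puv(4) by simp
      also have "\<dots> \<le> norm ((real i - real i') *\<^sub>R u + (real j - real j') *\<^sub>R v)" by (rule sep)
      also have "\<dots> = dist (z a) (z b)" unfolding ab z_def dist_norm by (simp add: algebra_simps)
      finally have "\<rho> + \<rho> \<le> dist (z a) (z b)" using \<rho>(3) by simp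
      then show ?thesis by (rule disjoint_ballI)
    qed
    have "vol (\<Union>a\<in>I. ball (z a) \<rho>) = (\<Sum>a\<in>I. vol (ball (z a) \<rho>))"
      using disj
      by (intro measure_negligible_finite_Union_image) (auto simp: I_def pairwise_def)
    also have "\<dots> = vol (ball 0 \<rho> :: (real^'n) set) * real k ^ 2"
      using \<rho>(1) by (simp add: content_ball I_def power2_eq_square)
    finally have "vol (ball 0 \<rho> :: (real^'n) set) * real k ^ 2 = vol (\<Union>a\<in>I. ball (z a) \<rho>)" ..
    also have "\<dots> \<le> vol ((*\<^sub>R) (2 * real k) ` M + E)"
    proof (rule measure_mono_fmeasurable)
      show "(\<Union>a\<in>I. ball (z a) \<rho>) \<subseteq> (*\<^sub>R) (2 * real k) ` M + E" using sub unfolding I_def by blast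
      show "(*\<^sub>R) (2 * real k) ` M + E \<in> lmeasurable"
        using cb by (intro lmeasurable_compact compact_set_plus compact_scaling) auto
    qed auto
    finally show ?thesis .
  qed
  moreover have "0 < vol (ball 0 \<rho> :: (real^'n) set)" using \<rho>(1) by simp
  ultimately show thesis using that by blast
qed

text \<open>By \<open>volume_scaled_add\<close>, \<open>a i\<close> is the coefficient of degree
  \<open>n - i\<close> in the dilation factor of \<open>M\<close>. The indices with
  \<open>i + 2 \<le> n\<close> are those of degree at least two, so their vanishing means linear
  growth.\<close>

lemma steiner_low_coefficients_zero_iff:
  fixes M E :: "(real ^ 'n) set"
  assumes M: "convex_body M" and E: "convex_body E" and dim: "aff_dim E = int CARD('n)"
    and nonneg: "\<And>i. 0 \<le> a i"
    and a: "\<And>t. 0 < t \<Longrightarrow> vol (M + (*\<^sub>R) t ` E) = (\<Sum>i\<le>CARD('n). a i * t ^ i)"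
  shows "(\<forall>i. i + 2 \<le> CARD('n) \<longrightarrow> a i = 0) \<longleftrightarrow> aff_dim M \<le> 1"
proof
  assume low: "\<forall>i. i + 2 \<le> CARD('n) \<longrightarrow> a i = 0"
  show "aff_dim M \<le> 1"
  proof (rule ccontr)
    assume "\<not> aff_dim M \<le> 1"
    then obtain c where c: "0 < c"
      "\<And>k::nat. 0 < k \<Longrightarrow> c * real k ^ 2 \<le> vol ((*\<^sub>R) (2 * real k) ` M + E)"
      using volume_planar_growth[OF M E dim] by blast
    \<comment> \<open>The surviving powers of \<open>2 * real k\<close> have exponent 0 or 1, hence
      are at most \<open>2 * real k\<close>.\<close>
    define C where "C = 2 * (\<Sum>i\<le>CARD('n). a i)"
    have "c * real k \<le> C" if k: "0 < k" for k :: nat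
    proof -
      have "c * real k ^ 2 \<le> (\<Sum>i\<le>CARD('n). a i * (2 * real k) ^ (CARD('n) - i))"
        using c(2)[OF k] volume_scaled_add[OF _ a, of "2 * real k"] k by simp
      also have "\<dots> \<le> (\<Sum>i\<le>CARD('n). a i * (2 * real k))"
      proof (rule sum_mono)
        fix i assume i: "i \<in> {..CARD('n)}"
        show "a i * (2 * real k) ^ (CARD('n) - i) \<le> a i * (2 * real k)"
        proof (cases "i + 2 \<le> CARD('n)")
          case True
          then show ?thesis using low by simp
        next
          case False
          with i have "CARD('n) - i = 0 \<or> CARD('n) - i = 1" by auto
          then show ?thesis using nonneg[of i] k by (auto intro!: mult_left_mono)
        qed
      qed
      also have "\<dots> = C * real k" by (simp add: C_def sum_distrib_left sum_distrib_right mult_ac)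
      finally show ?thesis using k by (simp add: power2_eq_square)
    qed
    moreover obtain k :: nat where "C / c < real k" using reals_Archimedean2 by blast
    then have "C < c * real (Suc k)" using c(1) by (simp add: field_simps)
    ultimately show False by (metis linorder_not_less zero_less_Suc)
  qed
next
  assume dimM: "aff_dim M \<le> 1"
  show "\<forall>i. i + 2 \<le> CARD('n) \<longrightarrow> a i = 0"
  proof (intro allI impI)
    fix i assume i: "i + 2 \<le> CARD('n)"
    have "a i * real k \<le> vol (M + E)" if k: "0 < k" for k :: nat
    proof -
      have "a i * real k ^ 2 \<le> a i * real k ^ (CARD('n) - i)"
        using i k nonneg by (intro mult_left_mono power_increasing) auto
      also have "\<dots> \<le> (\<Sum>i\<le>CARD('n). a i * real k ^ (CARD('n) - i))"
        using i nonneg by (intro member_le_sum[of i "{..CARD('n)}" "\<lambda>i. a i * real k ^ (CARD('n) - i)"]) auto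
      also have "\<dots> = vol ((*\<^sub>R) (real k) ` M + E)"
        using k by (intro volume_scaled_add[symmetric] a) auto
      also have "\<dots> \<le> vol (M + E) * real k" using volume_segment_growth[OF M E dimM k] by (simp add: mult.commute)
      finally show ?thesis using k by (simp add: power2_eq_square)
    qed
    note bound = this
    show "a i = 0"
    proof (rule ccontr)
      assume "a i \<noteq> 0"
      then have pos: "0 < a i" using nonneg[of i] by simp
      obtain k :: nat where "vol (M + E) / a i < real k" using reals_Archimedean2 by blast
      then have "vol (M + E) < a i * real (Suc k)" using pos by (simp add: field_simps)
      then show False using bound[of "Suc k"] by simp
    qed
  qed
qed

section \<open>The inequality and its equality case\<close>

theorem corollary1p1:
  fixes M E K :: "(real ^ 'n) set"
  assumes "CARD('n) \<ge> 2"
    and "convex_body M"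
    and "convex_body E"
    and "aff_dim E = int CARD('n)"
    and "K = M + E"
  shows "vol K \<ge> minkowski_content K E / (real CARD('n) - 1) - vol E / (real CARD('n) - 1) \<and>
    (vol K = minkowski_content K E / (real CARD('n) - 1) - vol E / (real CARD('n) - 1)
           \<longleftrightarrow> aff_dim M \<le> 1)"
proof -
  let ?n = "CARD('n)"
  obtain a where nonneg: "\<And>i. 0 \<le> a i"
    and a: "\<And>t. 0 < t \<Longrightarrow> vol (M + (*\<^sub>R) t ` E) = (\<Sum>i\<le>?n. a i * t ^ i)"
    using steiner_formula_nonneg[OF assms(2-4)] by blast
  have convE: "convex E" using assms(3) by (simp add: convex_body_def)
  \<comment> \<open>Coefficients of the polynomial re-expanded at \<open>1 + t\<close>, divided by
    the binomial factor of the Steiner formula. The value 0 beyond n meets the second condition of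
    \<open>steiner_coeffs\<close>.\<close>
  define w where "w j = (if j \<le> ?n then (\<Sum>i\<le>?n. a i * real (i choose j)) / real (?n choose j) else 0)" for j
  have "vol (K + (*\<^sub>R) t ` E) = (\<Sum>j=0..?n. real (?n choose j) * w j * t ^ j)" if t: "0 \<le> t" for t
  proof -
    have "K + (*\<^sub>R) t ` E = M + (*\<^sub>R) (1 + t) ` E"
      using scaleR_image_add_convex[OF convE, of 1 t] t unfolding assms(5) by (simp add: add.assoc)
    then have "vol (K + (*\<^sub>R) t ` E) = (\<Sum>i\<le>?n. a i * (t + 1) ^ i)" using a t by (simp add: add.commute)
    also have "\<dots> = (\<Sum>i\<le>?n. \<Sum>j\<le>?n. a i * real (i choose j) * t ^ j)"
    proof (rule sum.cong)
      fix i assume "i \<in> {..?n}"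
      then have "(\<Sum>j\<le>i. real (i choose j) * t ^ j) = (\<Sum>j\<le>?n. real (i choose j) * t ^ j)"
        by (intro sum.mono_neutral_left) (auto simp: binomial_eq_0)
      then show "a i * (t + 1) ^ i = (\<Sum>j\<le>?n. a i * real (i choose j) * t ^ j)"
        by (simp add: binomial_ring sum_distrib_left mult.assoc)
    qed simp
    also have "\<dots> = (\<Sum>j\<le>?n. \<Sum>i\<le>?n. a i * real (i choose j) * t ^ j)" by (rule sum.swap)
    also have "\<dots> = (\<Sum>j\<le>?n. real (?n choose j) * w j * t ^ j)"
      by (rule sum.cong) (auto simp: w_def sum_distrib_right)
    finally show ?thesis by (simp add: atLeast0AtMost)
  qed
  then have "steiner_coeffs K E w" unfolding steiner_coeffs_def by (simp add: w_def)
  then have "minkowski_content K E = real ?n * w 1"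
    unfolding minkowski_content_def by (simp only: quermassintegral_eq)
  also have "\<dots> = (\<Sum>i\<le>?n. a i * real i)" using assms(1) by (simp add: w_def)
  finally have S: "minkowski_content K E = (\<Sum>i\<le>?n. a i * real i)" .
  have volK: "vol K = (\<Sum>i\<le>?n. a i)" using a[of 1] assms(5) by simp
  have volE: "vol E = a ?n" using steiner_leading_coefficient[OF assms(2-4) a] .
  \<comment> \<open>The deficit in the inequality, multiplied by n - 1. The term for
    \<open>i = n - 1\<close> has factor 0, and the one for \<open>i = n\<close> cancels against
    \<open>vol E\<close>.\<close>
  define D where "D = (\<Sum>i\<in>{i. i + 2 \<le> ?n}. a i * (real ?n - 1 - real i))"
  have fin: "finite {i. i + 2 \<le> ?n}" by (rule finite_subset[of _ "{..?n}"]) auto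
  have "(real ?n - 1) * vol K - minkowski_content K E + vol E =
      (\<Sum>i\<le>?n. a i * (real ?n - 1 - real i) + (if i = ?n then a i else 0))"
    unfolding S volK volE
    by (simp add: sum.distrib sum_subtractf sum_distrib_left sum_distrib_right algebra_simps)
  also have "\<dots> = (\<Sum>i\<in>{i. i + 2 \<le> ?n}. a i * (real ?n - 1 - real i) + (if i = ?n then a i else 0))"
  proof (rule sum.mono_neutral_right)
    show "\<forall>i\<in>{..?n} - {i. i + 2 \<le> ?n}. a i * (real ?n - 1 - real i) + (if i = ?n then a i else 0) = 0"
    proof
      fix i assume "i \<in> {..?n} - {i. i + 2 \<le> ?n}"
      then have "i = ?n \<or> Suc i = ?n" by auto
      then show "a i * (real ?n - 1 - real i) + (if i = ?n then a i else 0) = 0"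
        by (auto simp flip: of_nat_Suc)
    qed
  qed auto
  also have "\<dots> = D" unfolding D_def by (rule sum.cong) auto
  finally have D: "(real ?n - 1) * vol K - minkowski_content K E + vol E = D" .
  have terms: "0 \<le> a i * (real ?n - 1 - real i)" if "i + 2 \<le> ?n" for i
    using nonneg that by (intro mult_nonneg_nonneg) auto
  have "0 \<le> D" unfolding D_def using terms by (intro sum_nonneg) auto
  moreover have "D = 0 \<longleftrightarrow> (\<forall>i. i + 2 \<le> ?n \<longrightarrow> a i = 0)"
    unfolding D_def using terms fin by (subst sum_nonneg_eq_0_iff) auto
  moreover have "(\<forall>i. i + 2 \<le> ?n \<longrightarrow> a i = 0) \<longleftrightarrow> aff_dim M \<le> 1"
    by (rule steiner_low_coefficients_zero_iff[OF assms(2-4) nonneg a])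
  moreover have pos: "0 < real ?n - 1" using assms(1) by simp
  moreover have "minkowski_content K E / (real ?n - 1) - vol E / (real ?n - 1) = vol K - D / (real ?n - 1)"
    unfolding D[symmetric] using pos by (simp add: diff_divide_distrib add_divide_distrib)
  ultimately show ?thesis by simp
qed

end
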